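(* Let $\alpha,\beta\in(0,\infty]$, let $a:=\alpha^{-1}$, $b:=\beta^{-1}$ (with $\infty^{-1}=0$), and let $n\ge1$ (with $n\ge2$ if $\alpha=\beta=\infty$). The joint probability generating function of the total numbers $N_\alpha$ and $N_\beta$ of symbols $\alpha$ and $\beta$ in the random $\alpha/\beta$-staircase tableau $S_{n,\alpha,\beta}$ is $$\mathbb E\bigl(x^{N_\alpha}y^{N_\beta}\bigr)=\prod_{i=0}^{n-1}\frac{\alpha x+\beta y+i\alpha\beta xy}{\alpha+\beta+i\alpha\beta}=\prod_{i=0}^{n-1}\frac{bx+ay+ixy}{a+b+i}$$ (the first product, in terms of $\alpha,\beta$, being read as a limit if a parameter is infinite). In other words, $$(N_\alpha,N_\beta)\overset{\mathrm d}{=}\Bigl(\sum_{i=0}^{n-1}I_i,\ \sum_{i=0}^{n-1}J_i\Bigr),$$ where $(I_i,J_i)$, $i=0,\dots,n-1$, are independent pairs of $0/1$-variables with the distributions $$\mathbb P(I_i=\iota,J_i=\iota')=\begin{cases}0,&(\iota,\iota')=(0,0),\\ \frac{b}{a+b+i},&(\iota,\iota')=(1,0),\\ \frac{a}{a+b+i},&(\iota,\iota')=(0,1),\\ \frac{i}{a+b+i},&(\iota,\iota')=(1,1).\end{cases}$$ In particular, the marginal distributions are $I_i\sim\operatorname{Be}\bigl(1-\frac{a}{a+b+i}\bigr)$ and $J_i\sim\operatorname{Be}\bigl(1-\frac{b}{a+b+i}\bigr)$. Hence, $$\mathbb E N_\alpha=\sum_{i=0}^{n-1}\Bigl(1-\frac{a}{a+b+i}\Bigr)=n-\sum_{i=0}^{n-1}\frac{a}{a+b+i},$$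 $$\operatorname{Var}N_\alpha=\sum_{i=0}^{n-1}\frac{a}{a+b+i}\Bigl(1-\frac{a}{a+b+i}\Bigr),$$ $$\operatorname{Cov}(N_\alpha,N_\beta)=-\sum_{i=0}^{n-1}\frac{ab}{(a+b+i)^2}.$$ In the case $\alpha=\beta=\infty$ ($a=b=0$) and $i=0$, one interprets $\frac{a}{a+b+i}=\frac{b}{a+b+i}=\frac12$ and $\frac{i}{a+b+i}=0$ in all these formulas (so $\frac{ab}{(a+b+i)^2}=\frac14$), and the $i=0$ factor in the generating function as $(x+y)/2$.
   Context: An $\alpha/\beta$-staircase tableau of size $n\ge1$ is a filling of the Young diagram of shape $(n,n-1,\dots,2,1)$, whose boxes are $(i,j)$ (row $i$ from the top, column $j$ from the left) with $i,j\ge1$, $i+j\le n+1$, such that: each box is empty or contains one of the symbols $\alpha,\beta$; no diagonal box (box with $i+j=n+1$) is empty; all boxes in the same row and to the left of a $\beta$ are empty; all boxes in the same column and above an $\alpha$ are empty. Let $\bar{\mathcal S}_n$ be the set of these tableaux. For $S\in\bar{\mathcal S}_n$ let $N_\alpha(S),N_\beta(S)$ be the numbers of symbols $\alpha$ and $\beta$ in $S$; in $N_\alpha,N_\beta$ the subscripts are symbols, not parameter values, and $N_\alpha:=N_\alpha(S_{n,\alpha,\beta})$, $N_\beta:=N_\beta(S_{n,\alpha,\beta})$. For parameter values $\alpha,\beta\in(0,\infty)$, $S_{n,\alpha,\beta}$ is the random element of $\bar{\mathcal S}_n$ with $\mathbb P(S_{n,\alpha,\beta}=S)=\alpha^{N_\alpha(S)}\beta^{N_\beta(S)}/Z_n(\alpha,\beta)$,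 where $Z_n(\alpha,\beta)=\sum_{S\in\bar{\mathcal S}_n}\alpha^{N_\alpha(S)}\beta^{N_\beta(S)}$. If exactly one of $\alpha,\beta$ is $\infty$, the distribution is the limit of this one as that parameter tends to $\infty$ with the other fixed; if $\alpha=\beta=\infty$, it is the limit as $\alpha=\beta\to\infty$. $\operatorname{Be}(p)$ is the Bernoulli distribution with parameter $p$. *)

theory Defs
  imports "HOL-Probability.Probability"
begin

datatype symbol = Alpha | Beta

text \<open>A filling maps a box (row, column), both counted from 1, to its content, with \<open>None\<close> for an
  empty box. Outside the diagram the value is fixed to \<open>None\<close>, so that distinct functions are
  distinct tableaux.\<close>

type_synonym filling = "nat \<times> nat \<Rightarrow> symbol option"

definition boxes :: "nat \<Rightarrow> (nat \<times> nat) set" where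
  "boxes n = {(i, j). 1 \<le> i \<and> 1 \<le> j \<and> i + j \<le> n + 1}"

definition staircase_tableaux :: "nat \<Rightarrow> filling set" where
  "staircase_tableaux n = {S.
     (\<forall>c. c \<notin> boxes n \<longrightarrow> S c = None) \<and>
     (\<forall>(i, j) \<in> boxes n. i + j = n + 1 \<longrightarrow> S (i, j) \<noteq> None) \<and>
     (\<forall>i j j'. S (i, j) = Some Beta \<and> j' < j \<longrightarrow> S (i, j') = None) \<and>
     (\<forall>i i' j. S (i, j) = Some Alpha \<and> i' < i \<longrightarrow> S (i', j) = None)}"

definition N_alpha :: "filling \<Rightarrow> nat" where
  "N_alpha S = card {c. S c = Some Alpha}"

definition N_beta :: "filling \<Rightarrow> nat" where
  "N_beta S = card {c. S c = Some Beta}"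

definition weight :: "real \<Rightarrow> real \<Rightarrow> filling \<Rightarrow> real" where
  "weight \<alpha> \<beta> S = \<alpha> ^ N_alpha S * \<beta> ^ N_beta S"

definition Z :: "nat \<Rightarrow> real \<Rightarrow> real \<Rightarrow> real" where
  "Z n \<alpha> \<beta> = (\<Sum>S \<in> staircase_tableaux n. weight \<alpha> \<beta> S)"

definition staircase_pmf_finite :: "nat \<Rightarrow> real \<Rightarrow> real \<Rightarrow> filling pmf" where
  "staircase_pmf_finite n \<alpha> \<beta> =
     embed_pmf (\<lambda>S. if S \<in> staircase_tableaux n then weight \<alpha> \<beta> S / Z n \<alpha> \<beta> else 0)"

text \<open>\<open>param_limit F \<alpha> \<beta> L\<close>: the value of \<open>F\<close> at \<open>(\<alpha>, \<beta>)\<close>, read as a limit if a parameter is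
  infinite, exists and equals \<open>L\<close>. If both are infinite, the limit is along the diagonal.\<close>

definition param_limit :: "(real \<Rightarrow> real \<Rightarrow> real) \<Rightarrow> ereal \<Rightarrow> ereal \<Rightarrow> real \<Rightarrow> bool" where
  "param_limit F \<alpha> \<beta> L \<longleftrightarrow>
     (if \<alpha> = \<infinity> \<and> \<beta> = \<infinity> then ((\<lambda>t. F t t) \<longlongrightarrow> L) at_top
      else if \<alpha> = \<infinity> then ((\<lambda>t. F t (real_of_ereal \<beta>)) \<longlongrightarrow> L) at_top
      else if \<beta> = \<infinity> then ((\<lambda>t. F (real_of_ereal \<alpha>) t) \<longlongrightarrow> L) at_top
      else F (real_of_ereal \<alpha>) (real_of_ereal \<beta>) = L)"

text \<open>The distribution of the random tableau for parameters in \<open>(0, \<infinity>]\<close>. As there are only finitely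
  many tableaux, convergence in distribution is pointwise convergence of the probabilities. That the
  description is proper is \<open>staircase_pmf_works\<close> below.\<close>

definition staircase_pmf :: "nat \<Rightarrow> ereal \<Rightarrow> ereal \<Rightarrow> filling pmf" where
  "staircase_pmf n \<alpha> \<beta> =
     (THE p. \<forall>S. param_limit (\<lambda>s t. pmf (staircase_pmf_finite n s t) S) \<alpha> \<beta> (pmf p S))"

text \<open>The following expressions, with \<open>a = 1/\<alpha>\<close> and \<open>b = 1/\<beta>\<close>, denote \<open>a/(a+b+i)\<close>, \<open>b/(a+b+i)\<close>,
  \<open>i/(a+b+i)\<close>, \<open>ab/(a+b+i)^2\<close> and \<open>(bx+ay+ixy)/(a+b+i)\<close>, with the conventions for \<open>a = b = 0\<close>
  and \<open>i = 0\<close>.\<close>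

definition frac_a :: "real \<Rightarrow> real \<Rightarrow> nat \<Rightarrow> real" where
  "frac_a a b i = (if a = 0 \<and> b = 0 \<and> i = 0 then 1/2 else a / (a + b + real i))"

definition frac_b :: "real \<Rightarrow> real \<Rightarrow> nat \<Rightarrow> real" where
  "frac_b a b i = (if a = 0 \<and> b = 0 \<and> i = 0 then 1/2 else b / (a + b + real i))"

definition frac_i :: "real \<Rightarrow> real \<Rightarrow> nat \<Rightarrow> real" where
  "frac_i a b i = (if a = 0 \<and> b = 0 \<and> i = 0 then 0 else real i / (a + b + real i))"

definition frac_ab :: "real \<Rightarrow> real \<Rightarrow> nat \<Rightarrow> real" where
  "frac_ab a b i = (if a = 0 \<and> b = 0 \<and> i = 0 then 1/4 else a * b / (a + b + real i)\<^sup>2)"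

definition pgf_factor :: "real \<Rightarrow> real \<Rightarrow> nat \<Rightarrow> real \<Rightarrow> real \<Rightarrow> real" where
  "pgf_factor a b i x y =
     (if a = 0 \<and> b = 0 \<and> i = 0 then (x + y) / 2
      else (b * x + a * y + real i * x * y) / (a + b + real i))"

text \<open>\<open>(I\<^sub>i, J\<^sub>i)\<close>, \<open>i < n\<close>, are independent pairs (the two components of a pair may be dependent) of
  0/1-variables on the probability space \<open>M\<close> with the prescribed joint distributions.\<close>

definition indep_01_pairs ::
  "real \<Rightarrow> real \<Rightarrow> nat \<Rightarrow> 'm measure \<Rightarrow> (nat \<Rightarrow> 'm \<Rightarrow> nat) \<Rightarrow> (nat \<Rightarrow> 'm \<Rightarrow> nat) \<Rightarrow> bool" where
  "indep_01_pairs a b n M I J \<longleftrightarrow>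
     prob_space M \<and>
     prob_space.indep_vars M (\<lambda>_. count_space UNIV) (\<lambda>i \<omega>. (I i \<omega>, J i \<omega>)) {..<n} \<and>
     (\<forall>i<n. \<forall>\<omega>\<in>space M. I i \<omega> \<in> {0, 1} \<and> J i \<omega> \<in> {0, 1}) \<and>
     (\<forall>i<n.
        measure M {\<omega> \<in> space M. I i \<omega> = 0 \<and> J i \<omega> = 0} = 0 \<and>
        measure M {\<omega> \<in> space M. I i \<omega> = 1 \<and> J i \<omega> = 0} = frac_b a b i \<and>
        measure M {\<omega> \<in> space M. I i \<omega> = 0 \<and> J i \<omega> = 1} = frac_a a b i \<and>
        measure M {\<omega> \<in> space M. I i \<omega> = 1 \<and> J i \<omega> = 1} = frac_i a b i)"

definition Be :: "real \<Rightarrow> nat pmf" where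
  "Be p = map_pmf of_bool (bernoulli_pmf p)"

definition covariance :: "'m measure \<Rightarrow> ('m \<Rightarrow> real) \<Rightarrow> ('m \<Rightarrow> real) \<Rightarrow> real" where
  "covariance M X Y = (LINT \<omega>|M. (X \<omega> - (LINT \<xi>|M. X \<xi>)) * (Y \<omega> - (LINT \<xi>|M. Y \<xi>)))"

lemma finite_staircase_tableaux: "finite (staircase_tableaux n)"
proof -
  have "finite (boxes n)"
    by (rule finite_subset[of _ "{..n+1} \<times> {..n+1}"]) (auto simp: boxes_def)
  moreover have "finite (UNIV :: symbol option set)"
  proof -
    have "(UNIV :: symbol set) \<subseteq> {Alpha, Beta}"
    proof
      show "x \<in> {Alpha, Beta}" for x by (cases x) simp_all
    qed
    then have "finite (UNIV :: symbol set)" by (rule finite_subset) simp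
    then show ?thesis by (simp add: UNIV_option_conv)
  qed
  ultimately have "finite {S :: filling. \<forall>x. (x \<in> boxes n \<longrightarrow> S x \<in> UNIV) \<and> (x \<notin> boxes n \<longrightarrow> S x = None)}"
    by (rule finite_set_of_finite_funs)
  then show ?thesis
    by (rule rev_finite_subset) (auto simp: staircase_tableaux_def)
qed

lemma staircase_tableaux_nonempty: "staircase_tableaux n \<noteq> {}"
proof -
  have "(\<lambda>(i, j). if (i, j) \<in> boxes n \<and> i + j = n + 1 then Some Alpha else None)
          \<in> staircase_tableaux n"
    by (auto simp: staircase_tableaux_def)
  then show ?thesis by blast
qed

lemma embed_finite:
  assumes "finite T" "\<And>S. S \<in> T \<Longrightarrow> f S \<ge> (0::real)" "\<And>S. S \<notin> T \<Longrightarrow> f S = 0" "(\<Sum>S\<in>T. f S) = 1"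
  shows "pmf (embed_pmf f) S = f S"
proof (rule pmf_embed_pmf)
  show "0 \<le> f x" for x using assms(2,3) by (cases "x \<in> T") auto
  have "(\<integral>\<^sup>+x. ennreal (f x) \<partial>count_space UNIV) = (\<Sum>x\<in>T. ennreal (f x))"
    using assms(1,3) by (intro nn_integral_count_space') auto
  also have "\<dots> = ennreal (\<Sum>x\<in>T. f x)" using assms(2) by simp
  finally show "(\<integral>\<^sup>+x. ennreal (f x) \<partial>count_space UNIV) = 1" using assms(4) by simp
qed

lemma pmf_staircase_pmf_finite:
  assumes "\<alpha> > 0" "\<beta> > 0"
  shows "pmf (staircase_pmf_finite n \<alpha> \<beta>) S =
    (if S \<in> staircase_tableaux n then weight \<alpha> \<beta> S / Z n \<alpha> \<beta> else 0)"
proof -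
  have Z: "Z n \<alpha> \<beta> > 0" unfolding Z_def
    using finite_staircase_tableaux staircase_tableaux_nonempty assms
    by (intro sum_pos) (auto simp: weight_def)
  show ?thesis unfolding staircase_pmf_finite_def
  proof (rule embed_finite[OF finite_staircase_tableaux])
    show "(\<Sum>S\<in>staircase_tableaux n.
        if S \<in> staircase_tableaux n then weight \<alpha> \<beta> S / Z n \<alpha> \<beta> else 0) = 1"
      using Z by (simp add: Z_def flip: sum_divide_distrib)
  qed (use Z assms in \<open>auto simp: weight_def\<close>)
qed

lemma limit_pmf_exists:
  fixes k :: "'s \<Rightarrow> nat" and c :: "'s \<Rightarrow> real"
  assumes T: "finite T" "T \<noteq> {}" and c: "\<And>S. S \<in> T \<Longrightarrow> c S > 0"
  shows "\<exists>p. \<forall>S. ((\<lambda>t. if S \<in> T then t ^ k S * c S / (\<Sum>S'\<in>T. t ^ k S' * c S') else 0)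
                    \<longlongrightarrow> pmf p S) at_top"
proof -
  define m where "m = Max (k ` T)"
  have le: "k S \<le> m" if "S \<in> T" for S using that T by (simp add: m_def)
  have "m \<in> k ` T" unfolding m_def using T by (intro Max_in) auto
  then obtain S0 where S0: "S0 \<in> T" "k S0 = m" by auto
  define d where "d S = (if k S = m then c S else 0)" for S
  define D where "D = (\<Sum>S\<in>T. d S)"
  have D: "D > 0" unfolding D_def
    by (rule sum_pos2[of _ S0]) (use T S0 c in \<open>auto simp: d_def less_imp_le\<close>)
  have lim1: "((\<lambda>t. t ^ k S * c S / t ^ m) \<longlongrightarrow> d S) at_top" if "S \<in> T" for S
  proof (cases "k S = m")
    case True
    have "eventually (\<lambda>t::real. t ^ k S * c S / t ^ m = d S) at_top"
      using eventually_gt_at_top[of 0] by eventually_elim (auto simp: True d_def)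
    then show ?thesis by (rule tendsto_eventually)
  next
    case False
    with le[OF that] have lt: "k S < m" by simp
    have "((\<lambda>t::real. c S / t ^ (m - k S)) \<longlongrightarrow> 0) at_top"
      using lt by (intro real_tendsto_divide_at_top[OF tendsto_const] filterlim_pow_at_top)
        (auto simp: filterlim_ident)
    moreover have "eventually (\<lambda>t::real. c S / t ^ (m - k S) = t ^ k S * c S / t ^ m) at_top"
      using eventually_gt_at_top[of 0]
      by eventually_elim (use lt in \<open>simp add: field_simps flip: power_add\<close>)
    ultimately show ?thesis using False by (simp add: d_def tendsto_cong)
  qed
  have lim: "((\<lambda>t. t ^ k S * c S / (\<Sum>S'\<in>T. t ^ k S' * c S')) \<longlongrightarrow> d S / D) at_top"
    if "S \<in> T" for S
  proof -
    have "((\<lambda>t. (t ^ k S * c S / t ^ m) / (\<Sum>S'\<in>T. t ^ k S' * c S' / t ^ m)) \<longlongrightarrow> d S / D) at_top"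
      unfolding D_def using D that
      by (intro tendsto_divide tendsto_sum lim1) (auto simp: D_def)
    moreover have "eventually (\<lambda>t. (t ^ k S * c S / t ^ m) / (\<Sum>S'\<in>T. t ^ k S' * c S' / t ^ m) =
        t ^ k S * c S / (\<Sum>S'\<in>T. t ^ k S' * c S')) at_top"
      using eventually_gt_at_top[of 0]
      by eventually_elim (simp flip: sum_divide_distrib)
    ultimately show ?thesis by (rule Lim_transform_eventually)
  qed
  have emb: "pmf (embed_pmf (\<lambda>S. if S \<in> T then d S / D else 0)) S
      = (if S \<in> T then d S / D else 0)" for S
  proof (rule embed_finite[OF T(1)])
    show "(\<Sum>S\<in>T. if S \<in> T then d S / D else 0) = 1"
      using D by (simp add: D_def flip: sum_divide_distrib)
  qed (use D c in \<open>auto simp: d_def intro!: divide_nonneg_pos less_imp_le\<close>)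
  show ?thesis
    by (rule exI[of _ "embed_pmf (\<lambda>S. if S \<in> T then d S / D else 0)"])
      (auto simp: emb intro: lim)
qed

lemma param_limit_unique: "param_limit F \<alpha> \<beta> L \<Longrightarrow> param_limit F \<alpha> \<beta> L' \<Longrightarrow> L = L'"
  by (auto simp: param_limit_def split: if_splits intro: tendsto_unique[OF trivial_limit_at_top_linorder])

lemma staircase_pmf_ex:
  assumes "\<alpha> > 0" "\<beta> > 0"
  shows "\<exists>p. \<forall>S. param_limit (\<lambda>s t. pmf (staircase_pmf_finite n s t) S) \<alpha> \<beta> (pmf p S)"
proof -
  note T = finite_staircase_tableaux[of n] staircase_tableaux_nonempty[of n]
  let ?T = "staircase_tableaux n"
  have pos: "real_of_ereal \<gamma> > 0" if "\<gamma> > 0" "\<gamma> \<noteq> \<infinity>" for \<gamma>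
    using that by (cases \<gamma>) auto
  consider "\<alpha> = \<infinity>" "\<beta> = \<infinity>" | "\<alpha> = \<infinity>" "\<beta> \<noteq> \<infinity>" | "\<alpha> \<noteq> \<infinity>" "\<beta> = \<infinity>" | "\<alpha> \<noteq> \<infinity>" "\<beta> \<noteq> \<infinity>"
    by blast
  then show ?thesis
  proof cases
    case 1
    obtain p where p: "((\<lambda>t. if S \<in> ?T then t ^ (N_alpha S + N_beta S) * 1 /
        (\<Sum>S'\<in>?T. t ^ (N_alpha S' + N_beta S') * 1) else 0) \<longlongrightarrow> pmf p S) at_top" for S
      using limit_pmf_exists[OF T, of "\<lambda>_. 1" "\<lambda>S. N_alpha S + N_beta S"] by auto
    have "((\<lambda>t. pmf (staircase_pmf_finite n t t) S) \<longlongrightarrow> pmf p S) at_top" for S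
      using p[of S] by (rule Lim_transform_eventually)
        (use eventually_gt_at_top[of 0] in eventually_elim,
          auto simp: pmf_staircase_pmf_finite Z_def weight_def power_add)
    then show ?thesis using 1 by (auto simp: param_limit_def)
  next
    case 2
    let ?b = "real_of_ereal \<beta>"
    have b: "?b > 0" using assms 2 pos by auto
    obtain p where p: "((\<lambda>t. if S \<in> ?T then t ^ N_alpha S * ?b ^ N_beta S /
        (\<Sum>S'\<in>?T. t ^ N_alpha S' * ?b ^ N_beta S') else 0) \<longlongrightarrow> pmf p S) at_top" for S
      using limit_pmf_exists[OF T, of "\<lambda>S. ?b ^ N_beta S" N_alpha] b by auto
    have "((\<lambda>t. pmf (staircase_pmf_finite n t ?b) S) \<longlongrightarrow> pmf p S) at_top" for S
      using p[of S] by (rule Lim_transform_eventually)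
        (use eventually_gt_at_top[of 0] in eventually_elim,
          use b in \<open>auto simp: pmf_staircase_pmf_finite Z_def weight_def\<close>)
    then show ?thesis using 2 by (auto simp: param_limit_def)
  next
    case 3
    let ?a = "real_of_ereal \<alpha>"
    have a: "?a > 0" using assms 3 pos by auto
    obtain p where p: "((\<lambda>t. if S \<in> ?T then t ^ N_beta S * ?a ^ N_alpha S /
        (\<Sum>S'\<in>?T. t ^ N_beta S' * ?a ^ N_alpha S') else 0) \<longlongrightarrow> pmf p S) at_top" for S
      using limit_pmf_exists[OF T, of "\<lambda>S. ?a ^ N_alpha S" N_beta] a by auto
    have "((\<lambda>t. pmf (staircase_pmf_finite n ?a t) S) \<longlongrightarrow> pmf p S) at_top" for S
      using p[of S] by (rule Lim_transform_eventually)
        (use eventually_gt_at_top[of 0] in eventually_elim,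
          use a in \<open>auto simp: pmf_staircase_pmf_finite Z_def weight_def mult.commute\<close>)
    then show ?thesis using 3 by (auto simp: param_limit_def)
  next
    case 4
    then show ?thesis by (auto simp: param_limit_def)
  qed
qed

lemma staircase_pmf_works:
  assumes "\<alpha> > 0" "\<beta> > 0"
  shows "param_limit (\<lambda>s t. pmf (staircase_pmf_finite n s t) S) \<alpha> \<beta> (pmf (staircase_pmf n \<alpha> \<beta>) S)"
proof -
  have "\<exists>!p. \<forall>S. param_limit (\<lambda>s t. pmf (staircase_pmf_finite n s t) S) \<alpha> \<beta> (pmf p S)"
  proof (rule ex_ex1I[OF staircase_pmf_ex[OF assms]])
    fix p q
    assume p: "\<forall>S. param_limit (\<lambda>s t. pmf (staircase_pmf_finite n s t) S) \<alpha> \<beta> (pmf p S)"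
      and q: "\<forall>S. param_limit (\<lambda>s t. pmf (staircase_pmf_finite n s t) S) \<alpha> \<beta> (pmf q S)"
    show "p = q"
      by (rule pmf_eqI, rule param_limit_unique[OF p[rule_format] q[rule_format]])
  qed
  from theI'[OF this] show ?thesis unfolding staircase_pmf_def by blast
qed

end

theory Submission
  imports Defs
begin

text \<open>
Everything follows from the product formula
\<open>Z n \<alpha> \<beta> = (\<Prod>i<n. \<alpha> + \<beta> + i * \<alpha> * \<beta>)\<close> for the partition function (\<open>Z_product\<close>), because for finite
parameters the generating function of the numbers of symbols is \<open>Z n (\<alpha> * x) (\<beta> * y) / Z n \<alpha> \<beta>\<close>.

The product formula is proved by building tableaux column by column, from right to left. A new first
column may have symbols only in the rows without a \<open>\<beta>\<close>, called free here, and in its lowest box, which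
is the new diagonal box and must be filled. Let \<open>G n z\<close> be the sum of the weights with an additional
factor \<open>z\<close> for each free row. Summing over the possible columns amounts to substituting \<open>z + \<beta>\<close> for \<open>z\<close>
and multiplying by a factor for the new row:
\<open>G (n + 1) z = (\<alpha> * z + \<beta>) * G n (z + \<beta>)\<close> (\<open>free_row_gf_Suc\<close>, based on
\<open>sum_columns_filled_product\<close> and \<open>add_column_bij\<close>). Hence
\<open>G n z = (\<Prod>i<n. \<alpha> * (z + i * \<beta>) + \<beta>)\<close>, and \<open>z = 1\<close> gives the claim.

Infinite parameters are limits. The set of tableaux is finite, so expectations converge, and each factor
of the product converges to its version in terms of \<open>a\<close> and \<open>b\<close> (\<open>param_limit_pgf_factor\<close>); this gives
the generating function in all cases (\<open>joint_pgf\<close>).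

Each factor of the product is the generating function of one pair \<open>(I\<^sub>i, J\<^sub>i)\<close>, so the product is that of
the sum of independent pairs. A generating function with bounded exponents determines the law
(\<open>joint_law_from_pgf\<close>), whence the equality in distribution (\<open>tableau_counts_law\<close>). The mean, variance and
covariance are then sums of the contributions of the single pairs, as the mixed covariances vanish by
independence (\<open>covariance_sums_01_pairs\<close>).
\<close>

section \<open>Fillings of a single column\<close>

text \<open>Only the rule for \<open>\<alpha>\<close> acts inside a column. The rule for \<open>\<beta>\<close> acts along rows, and enters through
the set \<open>F\<close> of rows in which the column may have a symbol.\<close>

definition columns :: "nat set \<Rightarrow> (nat \<Rightarrow> symbol option) set" where
  "columns F = {c. (\<forall>i. i \<notin> F \<longrightarrow> c i = None) \<and>
     (\<forall>i i'. c i = Some Alpha \<and> i' < i \<longrightarrow> c i' = None)}"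

text \<open>The variable \<open>z\<close> marks the rows that still have no \<open>\<beta>\<close> after the column has been put on their left.\<close>

fun entry_weight :: "real \<Rightarrow> real \<Rightarrow> real \<Rightarrow> symbol option \<Rightarrow> real" where
  "entry_weight p q z None = z"
| "entry_weight p q z (Some Alpha) = p * z"
| "entry_weight p q z (Some Beta) = q"

definition column_weight :: "real \<Rightarrow> real \<Rightarrow> real \<Rightarrow> nat set \<Rightarrow> (nat \<Rightarrow> symbol option) \<Rightarrow> real" where
  "column_weight p q z F c = (\<Prod>i\<in>F. entry_weight p q z (c i))"

lemma symbol_option_cases: "s = None \<or> s = Some Alpha \<or> s = Some Beta"
  by (cases s; cases "the s") auto

lemma finite_columns:
  assumes "finite F"
  shows "finite (columns F)"
proof -
  have "finite {c. \<forall>i. (i \<in> F \<longrightarrow> c i \<in> {None, Some Alpha, Some Beta}) \<and> (i \<notin> F \<longrightarrow> c i = None)}"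
    using assms by (intro finite_set_of_finite_funs) auto
  then show ?thesis
    by (rule rev_finite_subset) (use symbol_option_cases in \<open>auto simp: columns_def\<close>)
qed

lemma column_weight_Beta:
  assumes "m \<notin> F" "finite F"
  shows "column_weight p q z (insert m F) (c(m := Some Beta)) = q * column_weight p q z F c"
proof -
  have "(\<Prod>i\<in>F. entry_weight p q z ((c(m := Some Beta)) i)) = (\<Prod>i\<in>F. entry_weight p q z (c i))"
    using assms by (intro prod.cong) auto
  then show ?thesis using assms by (simp add: column_weight_def)
qed

lemma column_weight_Alpha:
  assumes "m \<notin> F" "finite F"
  shows "column_weight p q z (insert m F) ((\<lambda>_. None)(m := Some Alpha)) = p * z * z ^ card F"
proof -
  have "(\<Prod>i\<in>F. entry_weight p q z (((\<lambda>_. None)(m := Some Alpha)) i)) = (\<Prod>i\<in>F. z)"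
    using assms by (intro prod.cong) auto
  then show ?thesis using assms by (simp add: column_weight_def)
qed

text \<open>Rows are numbered downwards, so \<open>m\<close> is the lowest box. A \<open>\<beta>\<close> there does not constrain the boxes
above it, while an \<open>\<alpha>\<close> there forces all of them to be empty.\<close>

lemma columns_bottom_filled:
  assumes "\<forall>i\<in>F. i < m"
  shows "{c \<in> columns (insert m F). c m \<noteq> None} =
    insert ((\<lambda>_. None)(m := Some Alpha)) ((\<lambda>c. c(m := Some Beta)) ` columns F)" (is "?L = ?R")
proof
  show "?L \<subseteq> ?R"
  proof
    fix c assume c: "c \<in> ?L"
    show "c \<in> ?R"
    proof (cases "c m = Some Alpha")
      case True
      then have "c i = None" if "i \<noteq> m" for i
        using c assms that by (cases "i < m") (auto simp: columns_def)
      with True have "c = (\<lambda>_. None)(m := Some Alpha)" by auto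
      then show ?thesis by simp
    next
      case False
      with c have "c m = Some Beta" using symbol_option_cases[of "c m"] by auto
      then have "c = (c(m := None))(m := Some Beta)" by auto
      moreover have "c(m := None) \<in> columns F" using c by (auto simp: columns_def)
      ultimately show ?thesis by blast
    qed
  qed
  show "?R \<subseteq> ?L"
  proof
    fix c assume "c \<in> ?R"
    then consider "c = (\<lambda>_. None)(m := Some Alpha)" | d where "d \<in> columns F" "c = d(m := Some Beta)"
      by blast
    then show "c \<in> ?L"
    proof cases
      case 1
      then show ?thesis by (auto simp: columns_def)
    next
      case 2
      have "i < m" if "d i \<noteq> None" for i
        using that 2(1) assms by (cases "i \<in> F") (auto simp: columns_def)
      then have "\<not> m < i" if "d i = Some Alpha" for i using that
        by (metis option.distinct(1) less_asym)
      then show ?thesis using 2 by (auto simp: columns_def)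
    qed
  qed
qed

lemma sum_columns_bottom_filled:
  assumes "\<forall>i\<in>F. i < m" "finite F"
  shows "(\<Sum>c | c \<in> columns (insert m F) \<and> c m \<noteq> None. column_weight p q z (insert m F) c) =
    q * (\<Sum>c\<in>columns F. column_weight p q z F c) + p * z * z ^ card F"
proof -
  have m: "m \<notin> F" using assms by auto
  have none: "c m = None" if "c \<in> columns F" for c using that m by (auto simp: columns_def)
  have inj: "inj_on (\<lambda>c. c(m := Some Beta)) (columns F)"
    by (intro inj_onI) (metis none fun_upd_triv fun_upd_upd)
  have notin: "(\<lambda>_. None)(m := Some Alpha) \<notin> (\<lambda>c. c(m := Some Beta)) ` columns F"
    by (auto dest!: fun_cong[of _ _ m])
  have "(\<Sum>c | c \<in> columns (insert m F) \<and> c m \<noteq> None. column_weight p q z (insert m F) c) =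
      p * z * z ^ card F + (\<Sum>c\<in>columns F. column_weight p q z (insert m F) (c(m := Some Beta)))"
    unfolding columns_bottom_filled[OF assms(1)]
    by (subst sum.insert)
      (use finite_columns[OF assms(2)] notin m assms(2) in
        \<open>auto simp: sum.reindex[OF inj] column_weight_Alpha simp del: fun_upd_apply\<close>)
  then show ?thesis
    using m assms(2) by (simp add: column_weight_Beta sum_distrib_left del: fun_upd_apply)
qed

lemma sum_columns_insert:
  assumes "\<forall>i\<in>F. i < m" "finite F"
  shows "(\<Sum>c\<in>columns (insert m F). column_weight p q z (insert m F) c) =
    (z + q) * (\<Sum>c\<in>columns F. column_weight p q z F c) + p * z * z ^ card F"
proof -
  have m: "m \<notin> F" using assms by auto
  let ?w = "column_weight p q z (insert m F)"
  have "columns (insert m F) = columns F \<union> {c \<in> columns (insert m F). c m \<noteq> None}"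
    using m by (auto simp: columns_def)
  then have "(\<Sum>c\<in>columns (insert m F). ?w c) =
      (\<Sum>c\<in>columns F \<union> {c \<in> columns (insert m F). c m \<noteq> None}. ?w c)" by simp
  also have "\<dots> = (\<Sum>c\<in>columns F. ?w c) + (\<Sum>c | c \<in> columns (insert m F) \<and> c m \<noteq> None. ?w c)"
    using m finite_columns[of F] finite_columns[of "insert m F"] assms(2)
    by (intro sum.union_disjoint) (auto, auto simp: columns_def)
  also have "(\<Sum>c\<in>columns F. ?w c) = z * (\<Sum>c\<in>columns F. column_weight p q z F c)"
    unfolding sum_distrib_left
    by (intro sum.cong) (use m assms(2) in \<open>auto simp: column_weight_def columns_def\<close>)
  finally show ?thesis
    unfolding sum_columns_bottom_filled[OF assms] by (simp add: algebra_simps)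
qed

text \<open>Read from the bottom upwards, a column consists of empty boxes and \<open>\<beta>\<close>s up to its first \<open>\<alpha>\<close>, above
which it is empty. The sum over the position of that \<open>\<alpha>\<close> is geometric with ratio \<open>(z + q) / z\<close>, and it
telescopes to a single product. The induction on the largest row avoids a division by \<open>q\<close>, so the
identity holds for all real arguments.\<close>

lemma sum_columns_filled_product:
  assumes "finite F" "\<forall>i\<in>F. i < m"
  shows "(\<Sum>c | c \<in> columns (insert m F) \<and> c m \<noteq> None. column_weight p q z (insert m F) c) =
    (q + p * z) * (z + q) ^ card F"
proof -
  have "q * (\<Sum>c\<in>columns F. column_weight p q z F c) + p * z * z ^ card F =
      (q + p * z) * (z + q) ^ card F"
    using assms(1)
  proof (induction F rule: finite_linorder_max_induct)
    case empty
    have "columns {} = {\<lambda>_. None}" by (auto simp: columns_def)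
    then show ?case by (simp add: column_weight_def)
  next
    case (insert k F)
    let ?H = "\<Sum>c\<in>columns F. column_weight p q z F c"
    have card: "card (insert k F) = Suc (card F)" using insert by (subst card_insert_disjoint) auto
    have "(q + p * z) * (z + q) ^ card (insert k F) = (z + q) * (q * ?H + p * z * z ^ card F)"
      by (simp add: insert.IH card)
    then show ?case using insert.hyps
      by (simp add: sum_columns_insert card algebra_simps)
  qed
  then show ?thesis by (simp only: sum_columns_bottom_filled[OF assms(2,1)])
qed

section \<open>Adding a column to a tableau\<close>

text \<open>The rows to the left of which a further symbol may be placed: only a \<open>\<beta>\<close> in the row forbids that.\<close>

definition free_rows :: "nat \<Rightarrow> filling \<Rightarrow> nat set" where
  "free_rows n S = {i \<in> {1..n}. \<forall>j. S (i, j) \<noteq> Some Beta}"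

text \<open>Columns are counted from 1, so \<open>j = 0\<close> lies outside the diagram, where a tableau is empty.\<close>

definition add_column :: "(nat \<Rightarrow> symbol option) \<Rightarrow> filling \<Rightarrow> filling" where
  "add_column c S = (\<lambda>(i, j). if j = 0 then None else if j = 1 then c i else S (i, j - 1))"

definition new_columns :: "nat \<Rightarrow> filling \<Rightarrow> (nat \<Rightarrow> symbol option) set" where
  "new_columns n S = {c \<in> columns (insert (Suc n) (free_rows n S)). c (Suc n) \<noteq> None}"

lemma tableau_outside: "S \<in> staircase_tableaux n \<Longrightarrow> (i, j) \<notin> boxes n \<Longrightarrow> S (i, j) = None"
  unfolding staircase_tableaux_def by blast

lemma staircase_tableauxI:
  assumes "\<And>i j. (i, j) \<notin> boxes n \<Longrightarrow> S (i, j) = None"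
    and "\<And>i j. (i, j) \<in> boxes n \<Longrightarrow> i + j = n + 1 \<Longrightarrow> S (i, j) \<noteq> None"
    and "\<And>i j j'. S (i, j) = Some Beta \<Longrightarrow> j' < j \<Longrightarrow> S (i, j') = None"
    and "\<And>i i' j. S (i, j) = Some Alpha \<Longrightarrow> i' < i \<Longrightarrow> S (i', j) = None"
  shows "S \<in> staircase_tableaux n"
  unfolding staircase_tableaux_def
proof (intro CollectI conjI allI impI ballI)
  fix x assume "x \<notin> boxes n"
  then show "S x = None" using assms(1) by (cases x) simp
next
  fix x assume "x \<in> boxes n"
  then show "case x of (i, j) \<Rightarrow> i + j = n + 1 \<longrightarrow> S (i, j) \<noteq> None" using assms(2) by (cases x) blast
qed (elim conjE, rule assms(3,4); assumption)+

lemma add_column_in_tableaux: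
  assumes S: "S \<in> staircase_tableaux n" and c: "c \<in> new_columns n S"
  shows "add_column c S \<in> staircase_tableaux (Suc n)"
proof -
  let ?S = "add_column c S"
  have out: "?S x = None" if "x \<notin> boxes (Suc n)" for x
  proof (cases x)
    case (Pair i j)
    consider "j = 0" | "j = 1" | "j \<ge> 2" by linarith
    then show ?thesis
    proof cases
      case 2
      then show ?thesis using c Pair that
        by (auto simp: add_column_def new_columns_def columns_def free_rows_def boxes_def)
    next
      case 3
      then have "(i, j - 1) \<notin> boxes n" using that Pair by (auto simp: boxes_def)
      then show ?thesis using 3 Pair tableau_outside[OF S] by (auto simp: add_column_def)
    qed (use Pair in \<open>auto simp: add_column_def\<close>)
  qed
  have diag: "?S (i, j) \<noteq> None" if "(i, j) \<in> boxes (Suc n)" "i + j = Suc n + 1" for i j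
  proof (cases "j = 1")
    case True
    then show ?thesis using that c by (auto simp: add_column_def new_columns_def)
  next
    case False
    then have "(i, j - 1) \<in> boxes n" "i + (j - 1) = n + 1" using that by (auto simp: boxes_def)
    then have "S (i, j - 1) \<noteq> None" using S unfolding staircase_tableaux_def by blast
    then show ?thesis using that False by (auto simp: add_column_def boxes_def)
  qed
  have row: "?S (i, j') = None" if b: "?S (i, j) = Some Beta" and lt: "j' < j" for i j j'
  proof -
    consider "j' = 0" | "j' = 1" | "j' \<ge> 2" by linarith
    then show ?thesis
    proof cases
      case 2
      then have "S (i, j - 1) = Some Beta" using b lt by (auto simp: add_column_def split: if_splits)
      moreover from this have "i \<noteq> Suc n" using tableau_outside[OF S, of i "j - 1"] lt 2
        by (auto simp: boxes_def)
      ultimately have "i \<notin> insert (Suc n) (free_rows n S)" by (auto simp: free_rows_def)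
      then have "c i = None" using c by (auto simp: new_columns_def columns_def)
      then show ?thesis using 2 by (simp add: add_column_def)
    next
      case 3
      then have "S (i, j - 1) = Some Beta" "j' - 1 < j - 1" using b lt
        by (auto simp: add_column_def split: if_splits)
      then have "S (i, j' - 1) = None" using S unfolding staircase_tableaux_def by blast
      then show ?thesis by (auto simp: add_column_def) (use 3 in auto)
    qed (simp add: add_column_def)
  qed
  have col: "?S (i', j) = None" if a: "?S (i, j) = Some Alpha" and lt: "i' < i" for i i' j
  proof (cases "j \<ge> 2")
    case True
    then have "S (i, j - 1) = Some Alpha" using a by (auto simp: add_column_def split: if_splits)
    then have "S (i', j - 1) = None" using S lt unfolding staircase_tableaux_def by blast
    then show ?thesis using True by (auto simp: add_column_def)
  next
    case False
    then have "j = 1" "c i = Some Alpha" using a by (auto simp: add_column_def split: if_splits)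
    then show ?thesis using c lt by (auto simp: add_column_def new_columns_def columns_def)
  qed
  show ?thesis by (rule staircase_tableauxI) (fact out diag row col)+
qed

lemma tableau_split:
  assumes S: "S \<in> staircase_tableaux (Suc n)"
  defines "R \<equiv> \<lambda>(i, j). if j = 0 then None else S (i, j + 1)" and "c \<equiv> \<lambda>i. S (i, 1)"
  shows "R \<in> staircase_tableaux n" "c \<in> new_columns n R" "S = add_column c R"
proof -
  have row: "S (i, j') = None" if "S (i, j) = Some Beta" "j' < j" for i j j'
    using S that unfolding staircase_tableaux_def by blast
  have col: "S (i', j) = None" if "S (i, j) = Some Alpha" "i' < i" for i i' j
    using S that unfolding staircase_tableaux_def by blast
  have diag: "S (i, j) \<noteq> None" if "(i, j) \<in> boxes (Suc n)" "i + j = Suc n + 1" for i j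
    using S that unfolding staircase_tableaux_def by blast
  have "R (i, j) = None" if "(i, j) \<notin> boxes n" for i j
    using that tableau_outside[OF S, of i "j + 1"] by (auto simp: R_def boxes_def)
  moreover have "R (i, j) \<noteq> None" if "(i, j) \<in> boxes n" "i + j = n + 1" for i j
    using that diag[of i "j + 1"] by (auto simp: R_def boxes_def)
  moreover have "R (i, j') = None" if "R (i, j) = Some Beta" "j' < j" for i j j'
    using that row[of i "j + 1" "j' + 1"] by (auto simp: R_def split: if_splits)
  moreover have "R (i', j) = None" if "R (i, j) = Some Alpha" "i' < i" for i i' j
    using that col[of i "j + 1" i'] by (auto simp: R_def split: if_splits)
  ultimately show "R \<in> staircase_tableaux n"
    by (rule staircase_tableauxI)
  show "S = add_column c R"
  proof
    fix x show "S x = add_column c R x"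
      using tableau_outside[OF S, of "fst x" "snd x"]
      by (cases x) (auto simp: add_column_def c_def R_def boxes_def)
  qed
  have "c i = None" if i: "i \<notin> insert (Suc n) (free_rows n R)" for i
  proof (cases "i \<in> {1..Suc n}")
    case True
    then obtain j where "R (i, j) = Some Beta" using i by (auto simp: free_rows_def)
    then have "j \<noteq> 0" "S (i, j + 1) = Some Beta" by (auto simp: R_def split: if_splits)
    then show ?thesis using row[of i "j + 1" 1] by (simp add: c_def)
  next
    case False
    then show ?thesis unfolding c_def by (intro tableau_outside[OF S]) (auto simp: boxes_def)
  qed
  then show "c \<in> new_columns n R"
    using diag[of "Suc n" 1] col by (auto simp: new_columns_def columns_def c_def boxes_def)
qed

text \<open>Deleting the first column of a tableau of size \<open>n + 1\<close> leaves a tableau of size \<open>n\<close>: its diagonal and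
its rules are inherited. Conversely a column can be added exactly if it obeys the rule for \<open>\<alpha>\<close>, has
symbols only in free rows and in the new row \<open>n + 1\<close>, and is nonempty in the latter, which is the new
diagonal box.\<close>

lemma add_column_bij:
  "bij_betw (\<lambda>(S, c). add_column c S) (Sigma (staircase_tableaux n) (new_columns n))
     (staircase_tableaux (Suc n))"
proof (rule bij_betw_imageI)
  show "inj_on (\<lambda>(S, c). add_column c S) (Sigma (staircase_tableaux n) (new_columns n))"
  proof (rule inj_onI, clarify)
    fix S c S' c'
    assume S: "S \<in> staircase_tableaux n" "S' \<in> staircase_tableaux n"
      and eq: "add_column c S = add_column c' S'"
    have "c i = c' i" for i using fun_cong[OF eq, of "(i, 1)"] by (simp add: add_column_def)
    moreover have "S (i, j) = S' (i, j)" for i j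
    proof (cases j)
      case 0
      then show ?thesis using S by (simp add: tableau_outside boxes_def)
    next
      case (Suc k)
      then show ?thesis using fun_cong[OF eq, of "(i, j + 1)"] by (simp add: add_column_def)
    qed
    ultimately show "S = S' \<and> c = c'" by auto
  qed
  show "(\<lambda>(S, c). add_column c S) ` Sigma (staircase_tableaux n) (new_columns n) =
      staircase_tableaux (Suc n)"
  proof (intro equalityI subsetI)
    fix S assume "S \<in> staircase_tableaux (Suc n)"
    from tableau_split[OF this]
    show "S \<in> (\<lambda>(S, c). add_column c S) ` Sigma (staircase_tableaux n) (new_columns n)"
      by (auto intro!: rev_image_eqI)
  qed (auto simp: add_column_in_tableaux)
qed

lemma finite_boxes: "finite (boxes n)"
  by (rule finite_subset[of _ "{..n+1} \<times> {..n+1}"]) (auto simp: boxes_def)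

lemma finite_symbol:
  assumes "S \<in> staircase_tableaux n"
  shows "finite {x. S x = Some s}"
proof (rule finite_subset[OF _ finite_boxes[of n]], rule subsetI, rule ccontr)
  fix x assume "x \<in> {x. S x = Some s}" "x \<notin> boxes n"
  then show False using tableau_outside[OF assms] by (cases x) simp
qed

lemma card_symbol_add_column:
  assumes S: "S \<in> staircase_tableaux n" and c: "c \<in> new_columns n S"
  shows "card {x. add_column c S x = Some s} = card {i. c i = Some s} + card {x. S x = Some s}"
proof -
  let ?A = "(\<lambda>i. (i, 1::nat)) ` {i. c i = Some s}" and ?B = "(\<lambda>(i, j). (i, j + 1)) ` {x. S x = Some s}"
  have eq: "{x. add_column c S x = Some s} = ?A \<union> ?B"
  proof (intro equalityI subsetI)
    fix x assume "x \<in> {x. add_column c S x = Some s}"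
    moreover obtain i j where "x = (i, j)" by (cases x)
    ultimately consider "x = (i, 1)" "c i = Some s" | "x = (i, (j - 1) + 1)" "S (i, j - 1) = Some s"
      by (auto simp: add_column_def split: if_splits)
    then show "x \<in> ?A \<union> ?B"
    proof cases
      case 2
      then have "x \<in> ?B" by (intro image_eqI[of _ _ "(i, j - 1)"]) auto
      then show ?thesis ..
    qed auto
  next
    fix x assume "x \<in> ?A \<union> ?B"
    then show "x \<in> {x. add_column c S x = Some s}"
      using tableau_outside[OF S] by (auto simp: add_column_def boxes_def)
  qed
  have "finite {i. c i = Some s}"
    by (rule finite_subset[of _ "{..Suc n}"])
      (use c in \<open>auto simp: new_columns_def columns_def free_rows_def, metis atLeastAtMost_iff option.distinct(1) le_SucI order_refl\<close>)
  moreover have "?A \<inter> ?B = {}" using tableau_outside[OF S] by (auto simp: boxes_def)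
  ultimately have "card (?A \<union> ?B) = card ?A + card ?B"
    using finite_symbol[OF S, of s] by (subst card_Un_disjoint) auto
  then show ?thesis unfolding eq by (simp add: card_image inj_on_def)
qed

lemma free_rows_add_column:
  assumes S: "S \<in> staircase_tableaux n"
  shows "free_rows (Suc n) (add_column c S) =
    {i \<in> insert (Suc n) (free_rows n S). c i \<noteq> Some Beta}"
proof -
  have "(\<forall>j. add_column c S (i, j) \<noteq> Some Beta) \<longleftrightarrow>
      c i \<noteq> Some Beta \<and> (\<forall>j. S (i, j) \<noteq> Some Beta)" for i
  proof (intro iffI conjI allI)
    fix j assume *: "\<forall>j. add_column c S (i, j) \<noteq> Some Beta"
    show "c i \<noteq> Some Beta" using spec[OF *, of 1] by (simp add: add_column_def)
    show "S (i, j) \<noteq> Some Beta"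
      using spec[OF *, of "j + 1"] tableau_outside[OF S, of i 0]
      by (cases "j = 0") (auto simp: add_column_def boxes_def)
  qed (auto simp: add_column_def)
  moreover have "S (Suc n, j) \<noteq> Some Beta" for j
    using tableau_outside[OF S, of "Suc n" j] by (auto simp: boxes_def)
  ultimately show ?thesis by (auto simp: free_rows_def le_Suc_eq)
qed

lemma column_weight_eq:
  assumes "finite A" "\<And>i. i \<notin> A \<Longrightarrow> c i = None"
  shows "column_weight p q z A c =
    p ^ card {i. c i = Some Alpha} * q ^ card {i. c i = Some Beta} *
    z ^ card {i \<in> A. c i \<noteq> Some Beta}"
proof -
  have "entry_weight p q z s = (if s = Some Alpha then p else 1) *
      (if s = Some Beta then q else 1) * (if s \<noteq> Some Beta then z else 1)" for s
    using symbol_option_cases[of s] by auto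
  then have "column_weight p q z A c =
      (\<Prod>i\<in>A. if c i = Some Alpha then p else 1) * (\<Prod>i\<in>A. if c i = Some Beta then q else 1) *
      (\<Prod>i\<in>A. if c i \<noteq> Some Beta then z else 1)"
    by (simp only: column_weight_def prod.distrib)
  moreover have "{i \<in> A. c i = Some s} = {i. c i = Some s}" for s using assms(2) by force
  ultimately show ?thesis using assms(1) by (simp flip: prod.inter_filter)
qed

section \<open>The partition function\<close>

text \<open>The sum over tableaux has no closed recursion by itself, since the number of ways to add a column
depends on the number of free rows. Recording that number with a variable \<open>z\<close> repairs this.\<close>

definition free_row_gf :: "nat \<Rightarrow> real \<Rightarrow> real \<Rightarrow> real \<Rightarrow> real" where
  "free_row_gf n p q z = (\<Sum>S\<in>staircase_tableaux n. weight p q S * z ^ card (free_rows n S))"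

text \<open>Adding a column replaces the factor \<open>z\<close> of every free row by \<open>z + q\<close> and contributes one factor
\<open>q + p * z\<close> for the new row.\<close>

lemma free_row_gf_Suc: "free_row_gf (Suc n) p q z = (q + p * z) * free_row_gf n p q (z + q)"
proof -
  let ?w = "\<lambda>S. weight p q S * z ^ card (free_rows (Suc n) S)"
  have fin: "finite (free_rows n S)" "finite (new_columns n S)" for S
    by (auto simp: free_rows_def new_columns_def finite_columns)
  have w: "?w (add_column c S) =
      weight p q S * column_weight p q z (insert (Suc n) (free_rows n S)) c"
    if S: "S \<in> staircase_tableaux n" and c: "c \<in> new_columns n S" for S c
  proof -
    have "column_weight p q z (insert (Suc n) (free_rows n S)) c =
        p ^ card {i. c i = Some Alpha} * q ^ card {i. c i = Some Beta} *
        z ^ card (free_rows (Suc n) (add_column c S))"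
      unfolding free_rows_add_column[OF S]
      by (rule column_weight_eq) (use fin c in \<open>auto simp: new_columns_def columns_def\<close>)
    then show ?thesis
      by (simp add: weight_def N_alpha_def N_beta_def card_symbol_add_column[OF S c] power_add)
  qed
  have "free_row_gf (Suc n) p q z =
      (\<Sum>(S, c)\<in>Sigma (staircase_tableaux n) (new_columns n). ?w (add_column c S))"
    unfolding free_row_gf_def
    by (subst sum.reindex_bij_betw[OF add_column_bij, symmetric]) (simp add: case_prod_unfold)
  also have "\<dots> = (\<Sum>S\<in>staircase_tableaux n. \<Sum>c\<in>new_columns n S. ?w (add_column c S))"
    by (rule sum.Sigma[symmetric]) (auto simp: finite_staircase_tableaux fin)
  also have "\<dots> = (\<Sum>S\<in>staircase_tableaux n. weight p q S *
      (\<Sum>c\<in>new_columns n S. column_weight p q z (insert (Suc n) (free_rows n S)) c))"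
    unfolding sum_distrib_left by (intro sum.cong refl w)
  also have "\<dots> = (\<Sum>S\<in>staircase_tableaux n.
      weight p q S * ((q + p * z) * (z + q) ^ card (free_rows n S)))"
    unfolding new_columns_def
    by (intro sum.cong refl, subst sum_columns_filled_product) (auto simp: fin, auto simp: free_rows_def)
  finally show ?thesis by (simp only: free_row_gf_def sum_distrib_left mult_ac)
qed

lemma free_row_gf_product: "free_row_gf n p q z = (\<Prod>i<n. p * z + q + real i * p * q)"
proof (induction n arbitrary: z)
  case 0
  have no_boxes: "boxes 0 = {}" by (auto simp: boxes_def)
  have "S = (\<lambda>_. None)" if "S \<in> staircase_tableaux 0" for S
    using tableau_outside[OF that] by (intro ext) (simp add: no_boxes split_paired_all)
  moreover have "(\<lambda>_. None) \<in> staircase_tableaux 0"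
    by (rule staircase_tableauxI) (simp_all add: no_boxes)
  ultimately have "staircase_tableaux 0 = {\<lambda>_. None}" by blast
  then show ?case
    by (simp add: free_row_gf_def weight_def N_alpha_def N_beta_def free_rows_def)
next
  case (Suc n)
  show ?case
    unfolding free_row_gf_Suc Suc prod.lessThan_Suc_shift
    by (intro arg_cong2[of _ _ _ _ "(*)"] prod.cong) (auto simp: algebra_simps)
qed

lemma Z_product: "Z n p q = (\<Prod>i<n. p + q + real i * p * q)"
  using free_row_gf_product[of n p q 1] by (simp add: free_row_gf_def Z_def)

section \<open>Infinite parameters as limits\<close>

text \<open>Finite parameters are covered by a principal filter, so that the four cases in the definition of
\<open>param_limit\<close> become one filter limit, to which the calculus of limits applies.\<close>

definition param_filter :: "ereal \<Rightarrow> ereal \<Rightarrow> (real \<times> real) filter" where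
  "param_filter \<alpha> \<beta> =
     (if \<alpha> = \<infinity> \<and> \<beta> = \<infinity> then filtermap (\<lambda>t. (t, t)) at_top
      else if \<alpha> = \<infinity> then filtermap (\<lambda>t. (t, real_of_ereal \<beta>)) at_top
      else if \<beta> = \<infinity> then filtermap (\<lambda>t. (real_of_ereal \<alpha>, t)) at_top
      else principal {(real_of_ereal \<alpha>, real_of_ereal \<beta>)})"

lemma tendsto_principal_singleton_iff:
  fixes f :: "'a \<Rightarrow> real"
  shows "(f \<longlongrightarrow> L) (principal {p}) \<longleftrightarrow> f p = L"
proof
  assume "(f \<longlongrightarrow> L) (principal {p})"
  moreover have "(f \<longlongrightarrow> f p) (principal {p})"
    by (intro tendsto_eventually) (simp add: eventually_principal)
  moreover have "principal {p} \<noteq> bot" by (simp add: principal_eq_bot_iff)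
  ultimately show "f p = L" using tendsto_unique by blast
qed (auto intro!: tendsto_eventually simp: eventually_principal)

lemma param_limit_iff_tendsto:
  "param_limit F \<alpha> \<beta> L \<longleftrightarrow> ((\<lambda>p. F (fst p) (snd p)) \<longlongrightarrow> L) (param_filter \<alpha> \<beta>)"
  by (simp add: param_limit_def param_filter_def filterlim_filtermap tendsto_principal_singleton_iff)

lemma real_of_ereal_pos: "0 < \<gamma> \<Longrightarrow> \<gamma> \<noteq> \<infinity> \<Longrightarrow> 0 < real_of_ereal \<gamma>"
  by (cases \<gamma>) auto

lemma eventually_param_filter_pos:
  assumes "0 < \<alpha>" "0 < \<beta>"
  shows "\<forall>\<^sub>F p in param_filter \<alpha> \<beta>. 0 < fst p \<and> 0 < snd p"
  using assms real_of_ereal_pos[of \<alpha>] real_of_ereal_pos[of \<beta>] eventually_gt_at_top[of "0::real"]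
  by (auto simp: param_filter_def eventually_filtermap eventually_principal)

lemma real_of_ereal_inverse_nonneg: "0 < \<gamma> \<Longrightarrow> 0 \<le> real_of_ereal (inverse \<gamma>)"
  by (cases \<gamma>) auto

lemma tendsto_inverse_params:
  assumes "0 < \<alpha>" "0 < \<beta>"
  shows "((\<lambda>p. inverse (fst p)) \<longlongrightarrow> real_of_ereal (inverse \<alpha>)) (param_filter \<alpha> \<beta>)"
    and "((\<lambda>p. inverse (snd p)) \<longlongrightarrow> real_of_ereal (inverse \<beta>)) (param_filter \<alpha> \<beta>)"
  using assms tendsto_inverse_0_at_top[OF filterlim_ident]
  by (auto simp: param_filter_def filterlim_filtermap tendsto_principal_singleton_iff
      inverse_eq_divide)

text \<open>Dividing numerator and denominator by \<open>st\<close> turns the factor into a continuous function of \<open>1/s\<close> and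
\<open>1/t\<close>, which tend to \<open>a\<close> and \<open>b\<close>. This fails only if the limiting denominator vanishes, that is, for
\<open>a = b = i = 0\<close>. There both parameters are infinite and the limit is taken along \<open>s = t\<close>, where the
factor is constantly \<open>(x + y) / 2\<close>.\<close>

lemma param_limit_pgf_factor:
  assumes pos: "0 < \<alpha>" "0 < \<beta>"
    and a: "a = real_of_ereal (inverse \<alpha>)" and b: "b = real_of_ereal (inverse \<beta>)"
  shows "param_limit (\<lambda>s t. (s * x + t * y + real i * s * t * x * y) / (s + t + real i * s * t))
    \<alpha> \<beta> (pgf_factor a b i x y)"
proof (cases "a = 0 \<and> b = 0 \<and> i = 0")
  case True
  have "\<gamma> = \<infinity>" if "0 < \<gamma>" "real_of_ereal (inverse \<gamma>) = 0" for \<gamma>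
    using that by (cases \<gamma>) auto
  then have inf: "\<alpha> = \<infinity>" "\<beta> = \<infinity>" using True pos a b by auto
  have "\<forall>\<^sub>F t in at_top. (t * x + t * y) / (t + t) = (x + y) / (2::real)"
    using eventually_gt_at_top[of "0::real"] by eventually_elim (simp add: field_simps)
  then show ?thesis using True inf
    by (auto simp: param_limit_def pgf_factor_def intro!: tendsto_eventually)
next
  case False
  have "0 \<le> a" "0 \<le> b" using pos a b real_of_ereal_inverse_nonneg by auto
  then have "a + b + real i \<noteq> 0" using False by (simp add: add_nonneg_eq_0_iff)
  then have "((\<lambda>p. (inverse (snd p) * x + inverse (fst p) * y + real i * x * y) /
      (inverse (fst p) + inverse (snd p) + real i)) \<longlongrightarrow>
      (b * x + a * y + real i * x * y) / (a + b + real i)) (param_filter \<alpha> \<beta>)"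
    unfolding a b by (intro tendsto_intros tendsto_inverse_params pos)
  moreover have "\<forall>\<^sub>F p in param_filter \<alpha> \<beta>.
      (inverse (snd p) * x + inverse (fst p) * y + real i * x * y) /
        (inverse (fst p) + inverse (snd p) + real i) =
      (fst p * x + snd p * y + real i * fst p * snd p * x * y) /
        (fst p + snd p + real i * fst p * snd p)"
    using eventually_param_filter_pos[OF pos]
  proof eventually_elim
    case (elim p)
    then have "0 < fst p + snd p + real i * fst p * snd p"
      "0 < inverse (fst p) + inverse (snd p) + real i"
      by (auto intro!: add_pos_nonneg)
    then show ?case using elim by (simp add: frac_eq_eq) (simp add: field_simps)
  qed
  moreover have "pgf_factor a b i x y = (b * x + a * y + real i * x * y) / (a + b + real i)"
    using False unfolding pgf_factor_def by (rule if_not_P)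
  ultimately show ?thesis
    by (simp only: param_limit_iff_tendsto Lim_transform_eventually)
qed

section \<open>The joint probability generating function\<close>

text \<open>There are finitely many tableaux, so expectations inherit the limit from the probabilities.\<close>

lemma param_limit_expectation:
  assumes pos: "0 < \<alpha>" "0 < \<beta>"
  shows "param_limit (\<lambda>s t. \<Sum>S\<in>staircase_tableaux n. f S * (weight s t S / Z n s t)) \<alpha> \<beta>
    (measure_pmf.expectation (staircase_pmf n \<alpha> \<beta>) f)"
    and "set_pmf (staircase_pmf n \<alpha> \<beta>) \<subseteq> staircase_tableaux n"
proof -
  let ?P = "staircase_pmf n \<alpha> \<beta>" and ?T = "staircase_tableaux n"
  have lim: "((\<lambda>p. if S \<in> ?T then weight (fst p) (snd p) S / Z n (fst p) (snd p) else 0)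
      \<longlongrightarrow> pmf ?P S) (param_filter \<alpha> \<beta>)" for S
    using staircase_pmf_works[OF pos, of n S] unfolding param_limit_iff_tendsto
    by (rule Lim_transform_eventually)
      (use eventually_param_filter_pos[OF pos] in
        eventually_elim, auto simp: pmf_staircase_pmf_finite)
  have "pmf ?P S = 0" if "S \<notin> ?T" for S
    using lim[of S] that param_limit_unique[of "\<lambda>_ _. 0" \<alpha> \<beta> "pmf ?P S" 0]
    by (simp add: param_limit_iff_tendsto)
  then show sub: "set_pmf ?P \<subseteq> ?T" by (auto simp: set_pmf_eq)
  have "measure_pmf.expectation ?P f = (\<Sum>S\<in>?T. f S * pmf ?P S)"
    by (rule integral_measure_pmf_real) (use sub finite_staircase_tableaux in auto)
  moreover have "((\<lambda>p. \<Sum>S\<in>?T. f S * (weight (fst p) (snd p) S / Z n (fst p) (snd p)))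
      \<longlongrightarrow> (\<Sum>S\<in>?T. f S * pmf ?P S)) (param_filter \<alpha> \<beta>)"
  proof (intro tendsto_sum tendsto_mult tendsto_const)
    fix S assume "S \<in> ?T"
    then show "((\<lambda>p. weight (fst p) (snd p) S / Z n (fst p) (snd p)) \<longlongrightarrow> pmf ?P S)
        (param_filter \<alpha> \<beta>)" using lim[of S] by simp
  qed
  ultimately show "param_limit (\<lambda>s t. \<Sum>S\<in>?T. f S * (weight s t S / Z n s t)) \<alpha> \<beta>
      (measure_pmf.expectation ?P f)"
    by (simp add: param_limit_iff_tendsto)
qed

text \<open>For finite parameters the expectation of \<open>x ^ N\<^sub>\<alpha> * y ^ N\<^sub>\<beta>\<close> is the quotient of the partition function
at \<open>(s * x, t * y)\<close> and at \<open>(s, t)\<close>. Both products and expectations pass to the limit, and limits are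
unique.\<close>

lemma joint_pgf:
  fixes n :: nat
  assumes pos: "0 < \<alpha>" "0 < \<beta>"
    and a: "a = real_of_ereal (inverse \<alpha>)" and b: "b = real_of_ereal (inverse \<beta>)"
  defines "F \<equiv> \<lambda>x y s t. \<Prod>i<n. (s * x + t * y + real i * s * t * x * y) / (s + t + real i * s * t)"
    and "E \<equiv> \<lambda>x y. measure_pmf.expectation (staircase_pmf n \<alpha> \<beta>) (\<lambda>S. x ^ N_alpha S * y ^ N_beta S)"
  shows "param_limit (F x y) \<alpha> \<beta> (E x y)" and "E x y = (\<Prod>i<n. pgf_factor a b i x y)"
proof -
  have eq: "(\<Sum>S\<in>staircase_tableaux n. x ^ N_alpha S * y ^ N_beta S * (weight s t S / Z n s t)) = F x y s t"
    for s t
  proof -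
    have "(\<Sum>S\<in>staircase_tableaux n. x ^ N_alpha S * y ^ N_beta S * (weight s t S / Z n s t)) =
        Z n (s * x) (t * y) / Z n s t"
      unfolding Z_def sum_divide_distrib by (simp add: weight_def power_mult_distrib mult_ac)
    then show ?thesis by (simp add: Z_product F_def prod_dividef mult_ac)
  qed
  show lim: "param_limit (F x y) \<alpha> \<beta> (E x y)"
    using param_limit_expectation(1)[OF pos, where n = n and f = "\<lambda>S. x ^ N_alpha S * y ^ N_beta S"]
    unfolding eq E_def .
  have "param_limit (F x y) \<alpha> \<beta> (\<Prod>i<n. pgf_factor a b i x y)"
    using param_limit_pgf_factor[OF pos a b] unfolding F_def param_limit_iff_tendsto
    by (intro tendsto_prod)
  then show "E x y = (\<Prod>i<n. pgf_factor a b i x y)" by (rule param_limit_unique[OF lim])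
qed

section \<open>Independent pairs of 0/1-variables\<close>

lemma frac_identities:
  assumes "0 \<le> a" "0 \<le> b"
  shows frac_sum: "frac_a a b i + frac_b a b i + frac_i a b i = 1"
    and frac_nonneg: "0 \<le> frac_a a b i" "0 \<le> frac_b a b i" "0 \<le> frac_i a b i"
    and pgf_factor_frac: "pgf_factor a b i x y =
      frac_b a b i * x + frac_a a b i * y + frac_i a b i * x * y"
    and frac_ab_mult: "frac_ab a b i = frac_a a b i * frac_b a b i"
proof -
  have "a + b + real i \<noteq> 0" if "\<not> (a = 0 \<and> b = 0 \<and> i = 0)"
    using assms that by (simp add: add_nonneg_eq_0_iff)
  then show "frac_a a b i + frac_b a b i + frac_i a b i = 1"
    by (auto simp: frac_a_def frac_b_def frac_i_def simp flip: add_divide_distrib)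
qed (use assms in \<open>auto simp: frac_a_def frac_b_def frac_i_def pgf_factor_def frac_ab_def
    add_divide_distrib power2_eq_square\<close>)

text \<open>Evaluates the probability of any event as a finite sum that the simplifier can compute.\<close>

lemma measure_pmf_sum_over_support:
  "measure (measure_pmf p) A = (\<Sum>x\<in>F. if x \<in> A then pmf p x else 0)" if "finite F" "set_pmf p \<subseteq> F"
proof -
  have "measure (measure_pmf p) A = measure (measure_pmf p) (F \<inter> A)"
    by (intro measure_prob_cong_0) (use that in \<open>auto simp: set_pmf_iff\<close>)
  also have "\<dots> = (\<Sum>x\<in>F \<inter> A. pmf p x)" using that by (simp add: measure_measure_pmf_finite)
  also have "\<dots> = (\<Sum>x\<in>F. if x \<in> A then pmf p x else 0)" using that by (simp add: sum.inter_restrict)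
  finally show ?thesis .
qed

text \<open>A product of finitely many discrete distributions provides the pairs. The minimum with 1 makes the
coordinates 0/1-valued at every point of the space, not only almost surely.\<close>

lemma indep_01_pairs_exist:
  assumes "0 \<le> a" "0 \<le> b"
  shows "\<exists>(M :: (nat \<Rightarrow> nat \<times> nat) measure) I J. indep_01_pairs a b n M I J"
proof -
  define T :: "(nat \<times> nat) set" where "T = {(1, 0), (0, 1), (1, 1)}"
  define f where "f i z = (if z = (1, 0) then frac_b a b i else if z = (0, 1) then frac_a a b i
    else if z = (1, 1) then frac_i a b i else 0)" for i and z :: "nat \<times> nat"
  define p where "p i = embed_pmf (f i)" for i
  have p: "pmf (p i) z = f i z" for i z
    unfolding p_def
  proof (rule embed_finite[of T])
    show "sum (f i) T = 1" using frac_sum[OF assms, of i] by (simp add: T_def f_def)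
  qed (use frac_nonneg[OF assms] in \<open>auto simp: T_def f_def\<close>)
  have sub: "set_pmf (p i) \<subseteq> T" for i by (auto simp: set_pmf_iff p f_def T_def split: if_splits)
  have T: "finite T" by (simp add: T_def)
  define M where "M = measure_pmf (Pi_pmf {..<n} (0, 0) p)"
  define I J where "I i \<omega> = min 1 (fst (\<omega> i))" and "J i \<omega> = min 1 (snd (\<omega> i))"
    for i and \<omega> :: "nat \<Rightarrow> nat \<times> nat"
  have M: "measure M {\<omega> \<in> space M. I i \<omega> = k \<and> J i \<omega> = l} =
      measure (p i) {z. min 1 (fst z) = k \<and> min 1 (snd z) = l}" if "i < n" for i k l
  proof -
    have "p i = map_pmf (\<lambda>\<omega>. \<omega> i) (Pi_pmf {..<n} (0, 0) p)"
      using that by (simp add: Pi_pmf_component)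
    then show ?thesis by (simp add: M_def I_def J_def vimage_def)
  qed
  have "prob_space.indep_vars M (\<lambda>_. count_space UNIV) (\<lambda>i \<omega>. (I i \<omega>, J i \<omega>)) {..<n}"
    unfolding M_def I_def J_def
    by (rule prob_space.indep_vars_compose2[OF _ indep_vars_Pi_pmf,
          where Y = "\<lambda>_ z. (min 1 (fst z), min 1 (snd z))"])
      (auto intro: prob_space_measure_pmf)
  moreover have "prob_space M" by (simp add: M_def prob_space_measure_pmf)
  ultimately have "indep_01_pairs a b n M I J"
    unfolding indep_01_pairs_def
    by (auto simp: M measure_pmf_sum_over_support[OF T sub] T_def p f_def) (auto simp: I_def J_def)
  then show ?thesis by blast
qed

section \<open>Generating functions determine bounded laws\<close>

text \<open>A polynomial function of one real variable determines its coefficients; applied first in \<open>x\<close> for fixed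
\<open>y\<close>, and then in \<open>y\<close>.\<close>

lemma bivariate_polynomial_coeffs_unique:
  fixes c d :: "nat \<Rightarrow> nat \<Rightarrow> real"
  assumes "\<And>x y. (\<Sum>k\<le>N. \<Sum>l\<le>N. c k l * x ^ k * y ^ l) = (\<Sum>k\<le>N. \<Sum>l\<le>N. d k l * x ^ k * y ^ l)"
    and "k \<le> N" "l \<le> N"
  shows "c k l = d k l"
proof -
  have inner: "(\<Sum>l\<le>N. c k l * y ^ l) = (\<Sum>l\<le>N. d k l * y ^ l)" for y
  proof -
    have "\<forall>x. (\<Sum>k\<le>N. (\<Sum>l\<le>N. c k l * y ^ l) * x ^ k) = (\<Sum>k\<le>N. (\<Sum>l\<le>N. d k l * y ^ l) * x ^ k)"
      using assms(1)[of _ y] by (simp add: sum_distrib_right sum_distrib_left mult_ac)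
    then show ?thesis using assms(2) by (simp add: polyfun_eq_coeffs)
  qed
  then have "\<forall>y. (\<Sum>l\<le>N. c k l * y ^ l) = (\<Sum>l\<le>N. d k l * y ^ l)" by blast
  then show ?thesis using assms(3) by (simp add: polyfun_eq_coeffs)
qed

text \<open>For bounded variables the generating function is a polynomial whose coefficients are the point
probabilities.\<close>

lemma pgf_bounded_pair:
  fixes X Y :: "'a \<Rightarrow> nat"
  assumes "prob_space M" and XY: "(\<lambda>\<omega>. (X \<omega>, Y \<omega>)) \<in> M \<rightarrow>\<^sub>M count_space UNIV"
    and bd: "AE \<omega> in M. X \<omega> \<le> N \<and> Y \<omega> \<le> N"
  defines "D \<equiv> distr M (count_space UNIV) (\<lambda>\<omega>. (X \<omega>, Y \<omega>))"
  shows "(LINT \<omega>|M. x ^ X \<omega> * y ^ Y \<omega>) = (\<Sum>k\<le>N. \<Sum>l\<le>N. measure D {(k, l)} * x ^ k * (y::real) ^ l)"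
    and "\<not> (k \<le> N \<and> l \<le> N) \<Longrightarrow> measure D {(k, l)} = 0"
proof -
  interpret prob_space M by fact
  interpret D: prob_space D unfolding D_def by (rule prob_space_distr) (rule XY)
  have bdD: "AE z in D. fst z \<le> N \<and> snd z \<le> N"
    unfolding D_def using bd XY by (subst AE_distr_iff) auto
  show "measure D {(k, l)} = 0" if "\<not> (k \<le> N \<and> l \<le> N)"
  proof -
    have "AE z in D. z \<notin> {(k, l)}" using bdD by eventually_elim (use that in auto)
    then show ?thesis by (subst D.prob_eq_0) (auto simp: D_def)
  qed
  have "(LINT \<omega>|M. x ^ X \<omega> * y ^ Y \<omega>) = (LINT z|D. x ^ fst z * y ^ snd z)"
    unfolding D_def using XY by (subst integral_distr) auto
  also have "\<dots> = (LINT z|D. (\<Sum>k\<le>N. \<Sum>l\<le>N. x ^ k * y ^ l * indicator {(k, l)} z))"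
  proof (rule integral_cong_AE)
    show "AE z in D. x ^ fst z * y ^ snd z = (\<Sum>k\<le>N. \<Sum>l\<le>N. x ^ k * y ^ l * indicator {(k, l)} z)"
      using bdD
    proof eventually_elim
      case (elim z)
      have "(\<Sum>l\<le>N. x ^ k * y ^ l * indicator {(k, l)} z) =
          (if fst z = k then x ^ k * y ^ snd z else 0)" for k
      proof (cases "fst z = k")
        case True
        then have "x ^ k * y ^ l * indicator {(k, l)} z = (if snd z = l then x ^ k * y ^ l else 0)" for l
          by (cases z) (auto simp: indicator_def)
        then show ?thesis using True elim by simp
      next
        case False
        then have "indicator {(k, l)} z = (0::real)" for l by (auto simp: indicator_def)
        then show ?thesis using False by simp
      qed
      then show ?case using elim by simp
    qed
  qed (auto simp: D_def)
  also have "\<dots> = (\<Sum>k\<le>N. \<Sum>l\<le>N. measure D {(k, l)} * x ^ k * y ^ l)"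
  proof -
    have "integrable D (\<lambda>z. x ^ k * y ^ l * indicator {(k, l)} z)" for k l
      by (intro integrable_mult_right integrable_real_indicator)
        (auto simp: D_def D.emeasure_eq_measure[unfolded D_def])
    then show ?thesis
      by (simp add: D_def mult_ac)
  qed
  finally show "(LINT \<omega>|M. x ^ X \<omega> * y ^ Y \<omega>) = (\<Sum>k\<le>N. \<Sum>l\<le>N. measure D {(k, l)} * x ^ k * y ^ l)" .
qed

lemma joint_law_from_pgf:
  fixes X Y :: "'a \<Rightarrow> nat" and X' Y' :: "'b \<Rightarrow> nat"
  assumes M: "prob_space M" "(\<lambda>\<omega>. (X \<omega>, Y \<omega>)) \<in> M \<rightarrow>\<^sub>M count_space UNIV" "AE \<omega> in M. X \<omega> \<le> N \<and> Y \<omega> \<le> N"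
    and M': "prob_space M'" "(\<lambda>\<omega>. (X' \<omega>, Y' \<omega>)) \<in> M' \<rightarrow>\<^sub>M count_space UNIV" "AE \<omega> in M'. X' \<omega> \<le> N \<and> Y' \<omega> \<le> N"
    and pgf: "\<And>x y::real. (LINT \<omega>|M. x ^ X \<omega> * y ^ Y \<omega>) = (LINT \<omega>|M'. x ^ X' \<omega> * y ^ Y' \<omega>)"
  shows "distr M (count_space UNIV) (\<lambda>\<omega>. (X \<omega>, Y \<omega>)) = distr M' (count_space UNIV) (\<lambda>\<omega>. (X' \<omega>, Y' \<omega>))"
    (is "?D = ?D'")
proof (rule measure_eqI_countable[where A = UNIV])
  interpret D: prob_space ?D using M(1,2) by (rule prob_space.prob_space_distr)
  interpret D': prob_space ?D' using M'(1,2) by (rule prob_space.prob_space_distr)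
  fix z :: "nat \<times> nat"
  obtain k l where z: "z = (k, l)" by (cases z)
  have "measure ?D {(k, l)} = measure ?D' {(k, l)}"
  proof (cases "k \<le> N \<and> l \<le> N")
    case True
    have "(\<Sum>k\<le>N. \<Sum>l\<le>N. measure ?D {(k, l)} * x ^ k * y ^ l) =
        (\<Sum>k\<le>N. \<Sum>l\<le>N. measure ?D' {(k, l)} * x ^ k * y ^ l)" for x y
      using pgf[of x y] unfolding pgf_bounded_pair(1)[OF M] pgf_bounded_pair(1)[OF M'] .
    from bivariate_polynomial_coeffs_unique[OF this] True show ?thesis by blast
  next
    case False
    then show ?thesis using pgf_bounded_pair(2)[OF M] pgf_bounded_pair(2)[OF M'] by metis
  qed
  then show "emeasure ?D {z} = emeasure ?D' {z}"
    by (simp add: z D.emeasure_eq_measure D'.emeasure_eq_measure)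
qed auto

section \<open>Marginals and moments of independent pairs\<close>

lemma Be_law:
  assumes "prob_space M" and X: "X \<in> M \<rightarrow>\<^sub>M count_space UNIV"
    and X01: "\<And>\<omega>. \<omega> \<in> space M \<Longrightarrow> X \<omega> \<in> {0, 1}" and E: "(LINT \<omega>|M. real (X \<omega>)) = q"
  shows "distr M (count_space UNIV) X = measure_pmf (Be q)"
proof -
  interpret prob_space M by fact
  let ?D = "distr M (count_space UNIV) X"
  interpret D: prob_space ?D using X by (rule prob_space_distr)
  have meas: "{\<omega> \<in> space M. X \<omega> = k} \<in> sets M" for k
    using measurable_sets[OF X, of "{k}"] by (simp add: vimage_def Int_def conj_commute)
  have D: "measure ?D {k} = prob {\<omega> \<in> space M. X \<omega> = k}" for k
    using X by (subst measure_distr) (auto intro!: arg_cong[where f = prob])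
  have "(LINT \<omega>|M. real (X \<omega>)) = (LINT \<omega>|M. indicator {\<omega> \<in> space M. X \<omega> = 1} \<omega>)"
    using X01 by (intro Bochner_Integration.integral_cong) (auto simp: indicator_def)
  then have one: "prob {\<omega> \<in> space M. X \<omega> = 1} = q" using E meas by simp
  have "prob {\<omega> \<in> space M. X \<omega> = 0} = prob (space M - {\<omega> \<in> space M. X \<omega> = 1})"
    using X01 by (intro arg_cong[where f = prob]) auto
  then have zero: "prob {\<omega> \<in> space M. X \<omega> = 0} = 1 - q"
    using prob_compl[OF meas] one by simp
  have "0 \<le> q" "q \<le> 1" using one by auto
  moreover have "{x. x} = {True}" "{x. \<not> x} = {False}" by auto
  ultimately have Be: "pmf (Be q) k = (if k = 0 then 1 - q else if k = 1 then q else 0)" for k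
    by (auto simp: Be_def pmf_map vimage_def of_bool_def measure_pmf_single)
  show ?thesis
  proof (rule measure_eqI_countable[where A = UNIV])
    fix k :: nat
    have "measure ?D {k} = pmf (Be q) k"
    proof (cases "k \<le> 1")
      case True
      then have "k = 0 \<or> k = 1" by auto
      then show ?thesis using zero one by (auto simp: D Be)
    next
      case False
      then have no_value: "{\<omega> \<in> space M. X \<omega> = k} = {}" using X01 by force
      show ?thesis unfolding D no_value using False by (simp add: Be)
    qed
    then show "emeasure ?D {k} = emeasure (measure_pmf (Be q)) {k}"
      by (simp add: D.emeasure_eq_measure emeasure_pmf_single)
  qed auto
qed

text \<open>Each pair takes four values, one of them with probability 0, so every function of it is integrable,
with an integral that is a sum of three terms.\<close>

lemma integral_01_pair:
  fixes f :: "nat \<times> nat \<Rightarrow> real"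
  assumes ip: "indep_01_pairs a b n M I J" and i: "i < n"
  shows "integrable M (\<lambda>\<omega>. f (I i \<omega>, J i \<omega>))"
    and "(LINT \<omega>|M. f (I i \<omega>, J i \<omega>)) =
      f (1, 0) * frac_b a b i + f (0, 1) * frac_a a b i + f (1, 1) * frac_i a b i"
proof -
  interpret prob_space M using ip by (simp add: indep_01_pairs_def)
  have "(\<lambda>\<omega>. (I i \<omega>, J i \<omega>)) \<in> M \<rightarrow>\<^sub>M count_space UNIV"
    using ip i by (auto simp: indep_01_pairs_def indep_vars_def)
  then have "(\<lambda>\<omega>. (I i \<omega>, J i \<omega>)) -` {(k, l)} \<inter> space M \<in> sets M" for k l
    by (rule measurable_sets) simp
  then have meas: "{\<omega> \<in> space M. I i \<omega> = k \<and> J i \<omega> = l} \<in> sets M" for k l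
    by (simp add: vimage_def Int_def conj_commute)
  let ?g = "\<lambda>k l \<omega>. f (k, l) * indicator {\<omega> \<in> space M. I i \<omega> = k \<and> J i \<omega> = l} \<omega>"
  have int: "integrable M (?g k l)" for k l
    using meas by (intro integrable_mult_right integrable_real_indicator) (auto simp: emeasure_eq_measure)
  have eq: "f (I i \<omega>, J i \<omega>) = ?g 0 0 \<omega> + ?g 1 0 \<omega> + ?g 0 1 \<omega> + ?g 1 1 \<omega>" if "\<omega> \<in> space M" for \<omega>
  proof -
    have "I i \<omega> \<in> {0, 1} \<and> J i \<omega> \<in> {0, 1}" using ip i that by (auto simp: indep_01_pairs_def)
    then show ?thesis using that by (auto simp: indicator_def)
  qed
  have "integrable M (\<lambda>\<omega>. ?g 0 0 \<omega> + ?g 1 0 \<omega> + ?g 0 1 \<omega> + ?g 1 1 \<omega>)"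
    by (intro Bochner_Integration.integrable_add int)
  then show "integrable M (\<lambda>\<omega>. f (I i \<omega>, J i \<omega>))"
    by (subst Bochner_Integration.integrable_cong[OF refl eq])
  have "(LINT \<omega>|M. f (I i \<omega>, J i \<omega>)) = (LINT \<omega>|M. ?g 0 0 \<omega> + ?g 1 0 \<omega> + ?g 0 1 \<omega> + ?g 1 1 \<omega>)"
    by (rule Bochner_Integration.integral_cong[OF refl eq])
  also have "\<dots> = (LINT \<omega>|M. ?g 0 0 \<omega>) + (LINT \<omega>|M. ?g 1 0 \<omega>) + (LINT \<omega>|M. ?g 0 1 \<omega>) + (LINT \<omega>|M. ?g 1 1 \<omega>)"
    by (simp only: Bochner_Integration.integral_add int Bochner_Integration.integrable_add)
  also have "\<dots> = f (0, 0) * prob {\<omega> \<in> space M. I i \<omega> = 0 \<and> J i \<omega> = 0} +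
      f (1, 0) * prob {\<omega> \<in> space M. I i \<omega> = 1 \<and> J i \<omega> = 0} +
      f (0, 1) * prob {\<omega> \<in> space M. I i \<omega> = 0 \<and> J i \<omega> = 1} +
      f (1, 1) * prob {\<omega> \<in> space M. I i \<omega> = 1 \<and> J i \<omega> = 1}"
    using meas by simp
  also have "\<dots> = f (1, 0) * frac_b a b i + f (0, 1) * frac_a a b i + f (1, 1) * frac_i a b i"
    using ip i unfolding indep_01_pairs_def by simp
  finally show "(LINT \<omega>|M. f (I i \<omega>, J i \<omega>)) =
      f (1, 0) * frac_b a b i + f (0, 1) * frac_a a b i + f (1, 1) * frac_i a b i" .
qed

lemma prod_01_pairs:
  fixes f :: "nat \<Rightarrow> nat \<times> nat \<Rightarrow> real"
  assumes ip: "indep_01_pairs a b n M I J" and K: "K \<subseteq> {..<n}"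
  shows "integrable M (\<lambda>\<omega>. \<Prod>i\<in>K. f i (I i \<omega>, J i \<omega>))"
    and "(LINT \<omega>|M. (\<Prod>i\<in>K. f i (I i \<omega>, J i \<omega>))) = (\<Prod>i\<in>K. (LINT \<omega>|M. f i (I i \<omega>, J i \<omega>)))"
proof -
  interpret prob_space M using ip by (simp add: indep_01_pairs_def)
  have fin: "finite K" using K finite_subset by blast
  have "indep_vars (\<lambda>_. count_space UNIV) (\<lambda>i \<omega>. (I i \<omega>, J i \<omega>)) K"
    using ip K indep_vars_subset unfolding indep_01_pairs_def by blast
  then have ind: "indep_vars (\<lambda>_. borel) (\<lambda>i \<omega>. f i (I i \<omega>, J i \<omega>)) K"
    by (rule indep_vars_compose2) simp
  have int: "integrable M (\<lambda>\<omega>. f i (I i \<omega>, J i \<omega>))" if "i \<in> K" for i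
    using integral_01_pair(1)[OF ip] that K by blast
  show "integrable M (\<lambda>\<omega>. \<Prod>i\<in>K. f i (I i \<omega>, J i \<omega>))"
    by (rule indep_vars_integrable[OF fin ind int])
  show "(LINT \<omega>|M. (\<Prod>i\<in>K. f i (I i \<omega>, J i \<omega>))) = (\<Prod>i\<in>K. (LINT \<omega>|M. f i (I i \<omega>, J i \<omega>)))"
    by (rule indep_vars_lebesgue_integral[OF fin ind int])
qed

text \<open>After centering, the product of the two sums expands into products of functions of the \<open>i\<close>-th and the
\<open>j\<close>-th pair. For \<open>i \<noteq> j\<close> these are independent with mean 0, so only the diagonal survives. With
\<open>f = g\<close> this is the additivity of the variance.\<close>

lemma covariance_sums_01_pairs:
  fixes f g :: "nat \<times> nat \<Rightarrow> real"
  assumes ip: "indep_01_pairs a b n M I J"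
  shows "covariance M (\<lambda>\<omega>. \<Sum>i<n. f (I i \<omega>, J i \<omega>)) (\<lambda>\<omega>. \<Sum>i<n. g (I i \<omega>, J i \<omega>)) =
    (\<Sum>i<n. covariance M (\<lambda>\<omega>. f (I i \<omega>, J i \<omega>)) (\<lambda>\<omega>. g (I i \<omega>, J i \<omega>)))"
proof -
  interpret prob_space M using ip by (simp add: indep_01_pairs_def)
  let ?W = "\<lambda>i \<omega>. (I i \<omega>, J i \<omega>)"
  define F G where "F i z = f z - (LINT \<omega>|M. f (?W i \<omega>))" and "G i z = g z - (LINT \<omega>|M. g (?W i \<omega>))"
    for i z
  note int = integral_01_pair(1)[OF ip]
  have E0: "(LINT \<omega>|M. F i (?W i \<omega>)) = 0" if "i < n" for i
    using int[OF that, of f] by (simp add: F_def prob_space)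
  have pair: "integrable M (\<lambda>\<omega>. F i (?W i \<omega>) * G j (?W j \<omega>)) \<and>
      (LINT \<omega>|M. F i (?W i \<omega>) * G j (?W j \<omega>)) =
        (if j = i then covariance M (\<lambda>\<omega>. f (?W i \<omega>)) (\<lambda>\<omega>. g (?W i \<omega>)) else 0)"
    if "i < n" "j < n" for i j
  proof (cases "j = i")
    case True
    then show ?thesis using int[OF that(1), of "\<lambda>z. F i z * G i z"]
      by (simp add: covariance_def F_def G_def)
  next
    case False
    \<comment> \<open>The product rule for independent variables, with one function on each of the two coordinates.\<close>
    define h where "h k = (if k = i then F i else G j)" for k
    have K: "{i, j} \<subseteq> {..<n}" using that by simp
    have "(\<Prod>k\<in>{i, j}. h k (?W k \<omega>)) = F i (?W i \<omega>) * G j (?W j \<omega>)" for \<omega>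
      using False by (simp add: h_def)
    moreover have "(\<Prod>k\<in>{i, j}. (LINT \<omega>|M. h k (?W k \<omega>))) = 0"
      using False E0[OF that(1)] by (simp add: h_def)
    ultimately show ?thesis
      using prod_01_pairs[OF ip K, of h] False by simp
  qed
  have "covariance M (\<lambda>\<omega>. \<Sum>i<n. f (?W i \<omega>)) (\<lambda>\<omega>. \<Sum>i<n. g (?W i \<omega>)) =
      (LINT \<omega>|M. (\<Sum>i<n. F i (?W i \<omega>)) * (\<Sum>j<n. G j (?W j \<omega>)))"
  proof -
    have "(LINT \<omega>|M. (\<Sum>i<n. h (?W i \<omega>))) = (\<Sum>i<n. (LINT \<omega>|M. h (?W i \<omega>)))" for h :: "nat \<times> nat \<Rightarrow> real"
      by (rule Bochner_Integration.integral_sum) (use int in auto)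
    then show ?thesis by (simp add: covariance_def F_def G_def sum_subtractf)
  qed
  also have "\<dots> = (LINT \<omega>|M. (\<Sum>i<n. \<Sum>j<n. F i (?W i \<omega>) * G j (?W j \<omega>)))"
    by (simp add: sum_product)
  also have "\<dots> = (\<Sum>i<n. \<Sum>j<n. (LINT \<omega>|M. F i (?W i \<omega>) * G j (?W j \<omega>)))"
    by (subst Bochner_Integration.integral_sum;
        (intro sum.cong refl Bochner_Integration.integral_sum Bochner_Integration.integrable_sum)?)
      (use pair in auto)
  also have "\<dots> = (\<Sum>i<n. covariance M (\<lambda>\<omega>. f (?W i \<omega>)) (\<lambda>\<omega>. g (?W i \<omega>)))"
    by (intro sum.cong refl) (use pair in \<open>simp add: sum.delta\<close>)
  finally show ?thesis .
qed

lemma measurable_sums_01_pairs: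
  assumes ip: "indep_01_pairs a b n M I J"
  shows "(\<lambda>\<omega>. (\<Sum>i<n. I i \<omega>, \<Sum>i<n. J i \<omega>)) \<in> M \<rightarrow>\<^sub>M count_space UNIV"
proof -
  have W: "(\<lambda>\<omega>. (I i \<omega>, J i \<omega>)) \<in> M \<rightarrow>\<^sub>M count_space UNIV" if "i < n" for i
    using ip that by (auto simp: indep_01_pairs_def prob_space.indep_vars_def)
  have "(\<lambda>\<omega>. (\<Sum>i<m. I i \<omega>, \<Sum>i<m. J i \<omega>)) \<in> M \<rightarrow>\<^sub>M count_space UNIV" if "m \<le> n" for m
    using that
  proof (induction m)
    case (Suc m)
    let ?add = "\<lambda>z w. (fst z + fst w, snd z + snd w) :: nat \<times> nat"
    have "(\<lambda>\<omega>. ?add (\<Sum>i<m. I i \<omega>, \<Sum>i<m. J i \<omega>) (I m \<omega>, J m \<omega>)) \<in> M \<rightarrow>\<^sub>M count_space UNIV"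
    proof (rule measurable_compose_countable[where f = "\<lambda>z \<omega>. ?add z (I m \<omega>, J m \<omega>)"])
      show "(\<lambda>\<omega>. ?add z (I m \<omega>, J m \<omega>)) \<in> M \<rightarrow>\<^sub>M count_space UNIV" for z
        using W[of m] Suc.prems by (intro measurable_compose[OF W, of m "?add z"]) auto
      show "(\<lambda>\<omega>. (\<Sum>i<m. I i \<omega>, \<Sum>i<m. J i \<omega>)) \<in> M \<rightarrow>\<^sub>M count_space UNIV"
        using Suc by simp
    qed
    then show ?case by simp
  qed simp
  then show ?thesis by simp
qed

section \<open>The numbers of symbols in a random tableau\<close>

text \<open>Both laws have bounded support and the same generating function: by independence, that of the sums is
the product of the generating functions of the pairs.\<close>

lemma tableau_counts_law:
  assumes pos: "0 < \<alpha>" "0 < \<beta>"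
    and a: "a = real_of_ereal (inverse \<alpha>)" and b: "b = real_of_ereal (inverse \<beta>)"
    and ab: "0 \<le> a" "0 \<le> b"
    and ip: "indep_01_pairs a b n M I J"
  shows "distr (measure_pmf (staircase_pmf n \<alpha> \<beta>)) (count_space UNIV) (\<lambda>S. (N_alpha S, N_beta S)) =
    distr M (count_space UNIV) (\<lambda>\<omega>. (\<Sum>i<n. I i \<omega>, \<Sum>i<n. J i \<omega>))"
proof (rule joint_law_from_pgf[where N = "max n (card (boxes n))"])
  have M: "prob_space M" using ip by (simp add: indep_01_pairs_def)
  then show "prob_space M" .
  have "N_alpha S \<le> card (boxes n) \<and> N_beta S \<le> card (boxes n)" if "S \<in> staircase_tableaux n" for S
  proof -
    have "{x. S x = Some s} \<subseteq> boxes n" for s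
      using tableau_outside[OF that] by force
    then show ?thesis unfolding N_alpha_def N_beta_def
      using card_mono[OF finite_boxes] by blast
  qed
  then show "AE S in measure_pmf (staircase_pmf n \<alpha> \<beta>).
      N_alpha S \<le> max n (card (boxes n)) \<and> N_beta S \<le> max n (card (boxes n))"
    using param_limit_expectation(2)[OF pos, of n] by (force simp: AE_measure_pmf_iff le_max_iff_disj)
  have "(\<Sum>i<n. I i \<omega>) \<le> n \<and> (\<Sum>i<n. J i \<omega>) \<le> n" if "\<omega> \<in> space M" for \<omega>
  proof -
    have "I i \<omega> \<le> 1 \<and> J i \<omega> \<le> 1" if "i < n" for i
      using ip \<open>\<omega> \<in> space M\<close> that by (force simp: indep_01_pairs_def)
    then show ?thesis
      using sum_bounded_above[of "{..<n}" "\<lambda>i. I i \<omega>" 1] sum_bounded_above[of "{..<n}" "\<lambda>i. J i \<omega>" 1]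
      by simp
  qed
  then show "AE \<omega> in M. (\<Sum>i<n. I i \<omega>) \<le> max n (card (boxes n)) \<and>
      (\<Sum>i<n. J i \<omega>) \<le> max n (card (boxes n))"
    by (intro AE_I2) (force simp: le_max_iff_disj)
  fix x y :: real
  have "(LINT \<omega>|M. x ^ (\<Sum>i<n. I i \<omega>) * y ^ (\<Sum>i<n. J i \<omega>)) =
      (LINT \<omega>|M. (\<Prod>i<n. (\<lambda>z. x ^ fst z * y ^ snd z) (I i \<omega>, J i \<omega>)))"
    by (simp add: power_sum prod.distrib)
  also have "\<dots> = (\<Prod>i<n. (LINT \<omega>|M. (\<lambda>z. x ^ fst z * y ^ snd z) (I i \<omega>, J i \<omega>)))"
    by (rule prod_01_pairs(2)[OF ip subset_refl])
  also have "\<dots> = (\<Prod>i<n. pgf_factor a b i x y)"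
    by (intro prod.cong refl) (subst integral_01_pair(2)[OF ip], auto simp: pgf_factor_frac[OF ab])
  finally show "measure_pmf.expectation (staircase_pmf n \<alpha> \<beta>) (\<lambda>S. x ^ N_alpha S * y ^ N_beta S) =
      (LINT \<omega>|M. x ^ (\<Sum>i<n. I i \<omega>) * y ^ (\<Sum>i<n. J i \<omega>))"
    by (simp add: joint_pgf(2)[OF pos a b])
qed (use measurable_sums_01_pairs[OF ip] in \<open>auto simp: prob_space_measure_pmf\<close>)

lemma moments_eq_of_distr_eq:
  fixes f g :: "nat \<times> nat \<Rightarrow> real"
  assumes "distr M (count_space UNIV) X = distr M' (count_space UNIV) X'"
    and [measurable]: "X \<in> M \<rightarrow>\<^sub>M count_space UNIV" "X' \<in> M' \<rightarrow>\<^sub>M count_space UNIV"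
  shows "(LINT \<omega>|M. f (X \<omega>)) = (LINT \<omega>|M'. f (X' \<omega>))"
    and "covariance M (\<lambda>\<omega>. f (X \<omega>)) (\<lambda>\<omega>. g (X \<omega>)) = covariance M' (\<lambda>\<omega>. f (X' \<omega>)) (\<lambda>\<omega>. g (X' \<omega>))"
proof -
  have E: "(LINT \<omega>|M. h (X \<omega>)) = (LINT \<omega>|M'. h (X' \<omega>))" for h :: "nat \<times> nat \<Rightarrow> real"
    using arg_cong[OF assms(1), of "\<lambda>D. integral\<^sup>L D h"] by (simp add: integral_distr)
  show "(LINT \<omega>|M. f (X \<omega>)) = (LINT \<omega>|M'. f (X' \<omega>))" by (rule E)
  show "covariance M (\<lambda>\<omega>. f (X \<omega>)) (\<lambda>\<omega>. g (X \<omega>)) = covariance M' (\<lambda>\<omega>. f (X' \<omega>)) (\<lambda>\<omega>. g (X' \<omega>))"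
    unfolding covariance_def E by (rule E)
qed

lemma moments_01_pair:
  assumes ip: "indep_01_pairs a b n M I J" and i: "i < n" and ab: "0 \<le> a" "0 \<le> b"
  shows "(LINT \<omega>|M. real (I i \<omega>)) = 1 - frac_a a b i"
    and "(LINT \<omega>|M. real (J i \<omega>)) = 1 - frac_b a b i"
    and "covariance M (\<lambda>\<omega>. real (I i \<omega>)) (\<lambda>\<omega>. real (I i \<omega>)) = frac_a a b i * (1 - frac_a a b i)"
    and "covariance M (\<lambda>\<omega>. real (I i \<omega>)) (\<lambda>\<omega>. real (J i \<omega>)) = - frac_ab a b i"
proof -
  have i': "frac_i a b i = 1 - frac_a a b i - frac_b a b i" using frac_sum[OF ab, of i] by simp
  note E = integral_01_pair(2)[OF ip i]
  show EI: "(LINT \<omega>|M. real (I i \<omega>)) = 1 - frac_a a b i"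
    using E[of "\<lambda>z. real (fst z)"] by (simp add: i')
  show EJ: "(LINT \<omega>|M. real (J i \<omega>)) = 1 - frac_b a b i"
    using E[of "\<lambda>z. real (snd z)"] by (simp add: i')
  show "covariance M (\<lambda>\<omega>. real (I i \<omega>)) (\<lambda>\<omega>. real (I i \<omega>)) = frac_a a b i * (1 - frac_a a b i)"
    unfolding covariance_def EI
    using E[of "\<lambda>z. (real (fst z) - (1 - frac_a a b i)) * (real (fst z) - (1 - frac_a a b i))"]
    by (simp add: i' algebra_simps)
  show "covariance M (\<lambda>\<omega>. real (I i \<omega>)) (\<lambda>\<omega>. real (J i \<omega>)) = - frac_ab a b i"
    unfolding covariance_def EI EJ frac_ab_mult[OF ab]
    using E[of "\<lambda>z. (real (fst z) - (1 - frac_a a b i)) * (real (snd z) - (1 - frac_b a b i))"]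
    by (simp add: i' algebra_simps)
qed

lemma marginals_01_pair:
  assumes ip: "indep_01_pairs a b n M I J" and i: "i < n" and ab: "0 \<le> a" "0 \<le> b"
  shows "distr M (count_space UNIV) (I i) = measure_pmf (Be (1 - frac_a a b i))"
    and "distr M (count_space UNIV) (J i) = measure_pmf (Be (1 - frac_b a b i))"
proof -
  have M: "prob_space M" and W: "(\<lambda>\<omega>. (I i \<omega>, J i \<omega>)) \<in> M \<rightarrow>\<^sub>M count_space UNIV"
    using ip i by (auto simp: indep_01_pairs_def prob_space.indep_vars_def)
  have 01: "I i \<omega> \<in> {0, 1}" "J i \<omega> \<in> {0, 1}" if "\<omega> \<in> space M" for \<omega>
    using ip i that by (auto simp: indep_01_pairs_def)
  have "I i \<in> M \<rightarrow>\<^sub>M count_space UNIV" "J i \<in> M \<rightarrow>\<^sub>M count_space UNIV"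
    using measurable_compose[OF W, of fst] measurable_compose[OF W, of snd] by simp_all
  then show "distr M (count_space UNIV) (I i) = measure_pmf (Be (1 - frac_a a b i))"
    and "distr M (count_space UNIV) (J i) = measure_pmf (Be (1 - frac_b a b i))"
    using Be_law[OF M _ 01(1) moments_01_pair(1)[OF assms]]
      Be_law[OF M _ 01(2) moments_01_pair(2)[OF assms]] by blast+
qed

text \<open>Moments depend on the joint law only, so they may be computed for a sum of independent pairs.\<close>

lemma tableau_counts_moments:
  fixes n :: nat
  assumes pos: "0 < \<alpha>" "0 < \<beta>"
    and a: "a = real_of_ereal (inverse \<alpha>)" and b: "b = real_of_ereal (inverse \<beta>)"
    and ab: "0 \<le> a" "0 \<le> b"
  defines "P \<equiv> measure_pmf (staircase_pmf n \<alpha> \<beta>)"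
  shows "(LINT S|P. real (N_alpha S)) = (\<Sum>i<n. 1 - frac_a a b i)"
    and "covariance P (\<lambda>S. real (N_alpha S)) (\<lambda>S. real (N_alpha S)) =
      (\<Sum>i<n. frac_a a b i * (1 - frac_a a b i))"
    and "covariance P (\<lambda>S. real (N_alpha S)) (\<lambda>S. real (N_beta S)) = - (\<Sum>i<n. frac_ab a b i)"
proof -
  obtain M :: "(nat \<Rightarrow> nat \<times> nat) measure" and I J where ip: "indep_01_pairs a b n M I J"
    using indep_01_pairs_exist[OF ab] by blast
  have "(\<lambda>S. (N_alpha S, N_beta S)) \<in> measure_pmf (staircase_pmf n \<alpha> \<beta>) \<rightarrow>\<^sub>M count_space UNIV"
    by simp
  note law = moments_eq_of_distr_eq[OF tableau_counts_law[OF pos a b ab ip] this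
      measurable_sums_01_pairs[OF ip], folded P_def]
  note int = integral_01_pair(1)[OF ip]
  show "(LINT S|P. real (N_alpha S)) = (\<Sum>i<n. 1 - frac_a a b i)"
    using law(1)[of "\<lambda>z. real (fst z)"] int[of _ "\<lambda>z. real (fst z)"] moments_01_pair(1)[OF ip _ ab]
    by (simp add: of_nat_sum)
  show "covariance P (\<lambda>S. real (N_alpha S)) (\<lambda>S. real (N_alpha S)) =
      (\<Sum>i<n. frac_a a b i * (1 - frac_a a b i))"
    using law(2)[of "\<lambda>z. real (fst z)" "\<lambda>z. real (fst z)"] moments_01_pair(3)[OF ip _ ab]
      covariance_sums_01_pairs[OF ip, of "\<lambda>z. real (fst z)" "\<lambda>z. real (fst z)"]
    by (simp add: of_nat_sum)
  show "covariance P (\<lambda>S. real (N_alpha S)) (\<lambda>S. real (N_beta S)) = - (\<Sum>i<n. frac_ab a b i)"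
    using law(2)[of "\<lambda>z. real (fst z)" "\<lambda>z. real (snd z)"] moments_01_pair(4)[OF ip _ ab]
      covariance_sums_01_pairs[OF ip, of "\<lambda>z. real (fst z)" "\<lambda>z. real (snd z)"]
    by (simp add: of_nat_sum sum_negf)
qed

theorem theorem1p13:
  fixes \<alpha> \<beta> :: ereal and a b :: real and n :: nat and P :: "filling pmf"
  assumes "0 < \<alpha>" and "0 < \<beta>"
    and "a = real_of_ereal (inverse \<alpha>)" and "b = real_of_ereal (inverse \<beta>)"
    and "n \<ge> 1" and "\<alpha> = \<infinity> \<and> \<beta> = \<infinity> \<longrightarrow> n \<ge> 2"
    and "P = staircase_pmf n \<alpha> \<beta>"
  shows
    "(\<forall>x y :: real.
        param_limit
          (\<lambda>s t. \<Prod>i<n. (s * x + t * y + real i * s * t * x * y) / (s + t + real i * s * t))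
          \<alpha> \<beta> (measure_pmf.expectation P (\<lambda>S. x ^ N_alpha S * y ^ N_beta S)) \<and>
        measure_pmf.expectation P (\<lambda>S. x ^ N_alpha S * y ^ N_beta S)
          = (\<Prod>i<n. pgf_factor a b i x y))
     \<and> (\<exists>(M :: (nat \<Rightarrow> nat \<times> nat) measure) I J. indep_01_pairs a b n M I J)
     \<and> (\<forall>(M :: 'm measure) I J. indep_01_pairs a b n M I J \<longrightarrow>
          distr (measure_pmf P) (count_space UNIV) (\<lambda>S. (N_alpha S, N_beta S))
            = distr M (count_space UNIV) (\<lambda>\<omega>. (\<Sum>i<n. I i \<omega>, \<Sum>i<n. J i \<omega>)) \<and>
          (\<forall>i<n.
             distr M (count_space UNIV) (I i) = measure_pmf (Be (1 - frac_a a b i)) \<and>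
             distr M (count_space UNIV) (J i) = measure_pmf (Be (1 - frac_b a b i))))
     \<and> measure_pmf.expectation P (\<lambda>S. real (N_alpha S)) = (\<Sum>i<n. 1 - frac_a a b i)
     \<and> (\<Sum>i<n. 1 - frac_a a b i) = real n - (\<Sum>i<n. frac_a a b i)
     \<and> measure_pmf.variance P (\<lambda>S. real (N_alpha S)) = (\<Sum>i<n. frac_a a b i * (1 - frac_a a b i))
     \<and> covariance (measure_pmf P) (\<lambda>S. real (N_alpha S)) (\<lambda>S. real (N_beta S))
         = - (\<Sum>i<n. frac_ab a b i)"
proof -
  note pos = assms(1,2) and a = assms(3) and b = assms(4) and P = assms(7)
  have ab: "0 \<le> a" "0 \<le> b" using pos a b real_of_ereal_inverse_nonneg by auto
  note mom = tableau_counts_moments[OF pos a b ab, where n = n, folded P]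
  have var: "measure_pmf.variance P (\<lambda>S. real (N_alpha S)) = (\<Sum>i<n. frac_a a b i * (1 - frac_a a b i))"
    using mom(2) by (simp add: covariance_def power2_eq_square)
  have sub: "(\<Sum>i<n. 1 - frac_a a b i) = real n - (\<Sum>i<n. frac_a a b i)"
    by (simp add: sum_subtractf)
  show ?thesis
    using joint_pgf[OF pos a b, where n = n, folded P] indep_01_pairs_exist[OF ab, of n] mom(1,3) var sub
      tableau_counts_law[OF pos a b ab, where n = n, folded P] marginals_01_pair[OF _ _ ab]
    by blast
qed

end
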